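(* Let $(M,\mathcal{F})$ be an $n$-manifold with a codimension-$q$ Haefliger structure and let $\varphi: S^0\times 3D^n\hookrightarrow M$ be a smooth embedding. Then a strong foliation surgery $(M',\mathcal{F}')$ of $(M,\mathcal{F})$ along $\varphi$ exists. If $(M,\mathcal{F})$ is transversely oriented, then $(M',\mathcal{F}')$ can be chosen transversely orientable as well.
   Context: **Haefliger structures.** $\Gamma_q$ is the topological groupoid of germs of local $C^\infty$-diffeomorphisms of $\mathbb{R}^q$, with the étale (sheaf) topology. A codimension-$q$ Haefliger structure (also called a foliation) $(M,\mathcal{F})$ on a space $M$ consists of an open cover $\{U_\alpha\}$, continuous charts $f_\alpha: U_\alpha \to \mathbb{R}^q$, and continuous transition functions $\gamma_{\beta\alpha}: U_\alpha\cap U_\beta \to \Gamma_q$ such that for each $x\in U_\alpha\cap U_\beta$, $f_\beta = \gamma_{\beta\alpha}(x)\circ f_\alpha$ near $x$, and for each $x \in U_\alpha\cap U_\beta\cap U_\delta$, $\gamma_{\delta\alpha}(x) = \gamma_{\delta\beta}(x)\circ\gamma_{\beta\alpha}(x)$ near $f_\alpha(x)$. Two such are equivalent if they have a common refinement. Haefliger structures restrict to subspaces. No regularity is assumed. The normal bundle of $\mathcal{F}$ is the rank-$q$ vector bundle with transition cocycle given by the differentials of the germs $\gamma_{\beta\alpha}(x)$ at $f_\alpha(x)$; $\mathcal{F}$ is transversely oriented (orientable) when its normal bundle is oriented (orientable). **Surgery.** $rD^m$ is the closed disk of radius $r$ in $\mathbb{R}^m$. The surgered manifold $M'$ is obtained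 by removing $\varphi(S^0\times D^n)$ and gluing in $2D^1\times S^{n-1}$ by a radial identification (orientation reversing in the radial direction) $S^0\times(\mathrm{Int}(2D^n)\setminus D^n)\cong S^0\times(1,2)\times S^{n-1}\cong(\mathrm{Int}(2D^1)\setminus D^1)\times S^{n-1}$. The open manifold $\mathring M=M\setminus\varphi(S^0\times D^n)$ is thereby a submanifold of both $M$ and $M'$. The trace $W(M,M')$ is the cobordism obtained by attaching to $[0,1]\times M$ the handle $2D^1\times 2D^n$ along $\varphi$ at $\{1\}\times M$; its boundary is $M\cup M'$. **Foliation surgery.** A weak foliation surgery of $(M,\mathcal{F})$ along $\varphi$ is a Haefliger structure $(M',\mathcal{F}')$ that restricts to $\mathcal{F}$ on $\mathring M$. A lax foliation surgery is a Haefliger structure $(M',\mathcal{F}')$ such that there is a Haefliger structure on $W(M,M')$ with boundary restriction $(M,\mathcal{F})\cup(M',\mathcal{F}')$. A strong foliation surgery is one that is both weak and lax. *)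

theory Defs
  imports "HOL-Analysis.Analysis"
begin

section \<open>Smooth maps and smooth manifolds\<close>

text \<open>The following two notions are meant for open sets \<open>S\<close> only.\<close>

primrec C_k_on :: "nat \<Rightarrow> 'a set \<Rightarrow> ('a::euclidean_space \<Rightarrow> 'b::euclidean_space) \<Rightarrow> bool" where
  "C_k_on 0 S f \<longleftrightarrow> continuous_on S f"
| "C_k_on (Suc k) S f \<longleftrightarrow>
     (\<forall>x\<in>S. f differentiable (at x)) \<and> (\<forall>v. C_k_on k S (\<lambda>x. frechet_derivative f (at x) v))"

definition smooth_on :: "'a set \<Rightarrow> ('a::euclidean_space \<Rightarrow> 'b::euclidean_space) \<Rightarrow> bool" where
  "smooth_on S f \<longleftrightarrow> (\<forall>k. C_k_on k S f)"

text \<open>Manifolds have no boundary and need not be compact, connected or orientable.\<close>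

definition smooth_manifold :: "'a topology \<Rightarrow> ('a set \<times> ('a \<Rightarrow> real^'n)) set \<Rightarrow> bool" where
  "smooth_manifold M \<A> \<longleftrightarrow>
     Hausdorff_space M \<and> second_countable M \<and> (\<Union>(U, \<kappa>)\<in>\<A>. U) = topspace M \<and>
     (\<forall>(U, \<kappa>)\<in>\<A>. openin M U \<and> open (\<kappa> ` U) \<and>
        homeomorphic_map (subtopology M U) (top_of_set (\<kappa> ` U)) \<kappa>) \<and>
     (\<forall>(U, \<kappa>)\<in>\<A>. \<forall>(V, \<mu>)\<in>\<A>. smooth_on (\<kappa> ` (U \<inter> V)) (\<lambda>y. \<mu> (inv_into U \<kappa> y)))"

text \<open>
  \<open>S\<^sup>0\<close> is the subset \<open>{-1, 1}\<close> of the reals, and \<open>S\<^sup>0 \<times> 3D\<^sup>n\<close> is a subset of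
  \<open>real \<times> (real^'n)\<close>.  At points of the boundary of \<open>3D\<^sup>n\<close>, smoothness of a map means that it
  locally extends to a smooth map on an open set; at these points, too, the derivative of
  the extension is determined by the map.
\<close>

definition smooth_embedding_discs ::
  "'a topology \<Rightarrow> ('a set \<times> ('a \<Rightarrow> real^'n)) set \<Rightarrow> (real \<times> (real^'n) \<Rightarrow> 'a) \<Rightarrow> bool" where
  "smooth_embedding_discs M \<A> \<phi> \<longleftrightarrow>
     embedding_map (top_of_set (sphere 0 1 \<times> cball 0 3)) M \<phi> \<and>
     (\<forall>e\<in>sphere 0 1. \<forall>y\<in>cball 0 3. \<forall>(U, \<kappa>)\<in>\<A>. \<phi> (e, y) \<in> U \<longrightarrow>
        (\<exists>N g. open N \<and> y \<in> N \<and> smooth_on N g \<and>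
           (\<forall>z \<in> N \<inter> cball 0 3. \<phi> (e, z) \<in> U \<and> g z = \<kappa> (\<phi> (e, z))) \<and>
           inj (frechet_derivative g (at y))))"


section \<open>The groupoid \<open>\<Gamma>\<^sub>q\<close> of germs of local diffeomorphisms\<close>

definition local_diffeo :: "(real^'q) set \<Rightarrow> (real^'q \<Rightarrow> real^'q) \<Rightarrow> bool" where
  "local_diffeo V g \<longleftrightarrow>
     open V \<and> smooth_on V g \<and> inj_on g V \<and> open (g ` V) \<and> smooth_on (g ` V) (inv_into V g)"

text \<open>A germ consists of its source and of the class of all maps agreeing near the source.\<close>

type_synonym 'q germ = "(real^'q) \<times> (real^'q \<Rightarrow> real^'q) set"

definition germ :: "(real^'q \<Rightarrow> real^'q) \<Rightarrow> real^'q \<Rightarrow> 'q germ" where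
  "germ g x = (x, {h. \<forall>\<^sub>F y in nhds x. h y = g y})"

definition Gamma :: "'q::finite germ topology" where
  "Gamma = topology_generated_by {germ g ` V | V g. local_diffeo V g}"

text \<open>\<open>germ_comp b a\<close> is the composite \<open>b \<circ> a\<close>; it is meaningful when the target of \<open>a\<close> is
  the source of \<open>b\<close>.\<close>

definition germ_comp :: "'q::finite germ \<Rightarrow> 'q germ \<Rightarrow> 'q germ" where
  "germ_comp b a = (fst a, {h. \<exists>g\<in>snd a. \<exists>k\<in>snd b. \<forall>\<^sub>F y in nhds (fst a). h y = k (g y)})"

definition germ_differential :: "'q germ \<Rightarrow> real^'q^'q" where
  "germ_differential a = matrix (frechet_derivative (SOME g. g \<in> snd a) (at (fst a)))"

text \<open>\<open>f' = a \<circ> f\<close> near \<open>x\<close>.\<close>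

definition germ_carries ::
  "'a topology \<Rightarrow> 'q germ \<Rightarrow> ('a \<Rightarrow> real^'q) \<Rightarrow> ('a \<Rightarrow> real^'q) \<Rightarrow> 'a \<Rightarrow> bool" where
  "germ_carries X a f f' x \<longleftrightarrow>
     fst a = f x \<and> (\<exists>g\<in>snd a. \<exists>N. openin X N \<and> x \<in> N \<and> (\<forall>y\<in>N. f' y = g (f y)))"


section \<open>Haefliger structures\<close>

text \<open>\<open>hs_trans F \<beta> \<alpha>\<close> is the transition function \<open>\<gamma>\<^sub>\<beta>\<^sub>\<alpha>\<close>, which carries \<open>f\<^sub>\<alpha>\<close> to \<open>f\<^sub>\<beta>\<close>.\<close>

record ('i, 'a, 'q) haefliger =
  hs_index :: "'i set"
  hs_dom :: "'i \<Rightarrow> 'a set"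
  hs_chart :: "'i \<Rightarrow> 'a \<Rightarrow> real^'q"
  hs_trans :: "'i \<Rightarrow> 'i \<Rightarrow> 'a \<Rightarrow> 'q germ"

definition haefliger_structure :: "'a topology \<Rightarrow> ('i, 'a, 'q::finite) haefliger \<Rightarrow> bool" where
  "haefliger_structure X F \<longleftrightarrow>
     (\<forall>\<alpha>\<in>hs_index F. openin X (hs_dom F \<alpha>)) \<and>
     (\<Union>\<alpha>\<in>hs_index F. hs_dom F \<alpha>) = topspace X \<and>
     (\<forall>\<alpha>\<in>hs_index F. continuous_map (subtopology X (hs_dom F \<alpha>)) euclidean (hs_chart F \<alpha>)) \<and>
     (\<forall>\<alpha>\<in>hs_index F. \<forall>\<beta>\<in>hs_index F.
        continuous_map (subtopology X (hs_dom F \<alpha> \<inter> hs_dom F \<beta>)) Gamma (hs_trans F \<beta> \<alpha>) \<and>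
        (\<forall>x \<in> hs_dom F \<alpha> \<inter> hs_dom F \<beta>.
           germ_carries X (hs_trans F \<beta> \<alpha> x) (hs_chart F \<alpha>) (hs_chart F \<beta>) x)) \<and>
     (\<forall>\<alpha>\<in>hs_index F. \<forall>\<beta>\<in>hs_index F. \<forall>\<delta>\<in>hs_index F.
        \<forall>x \<in> hs_dom F \<alpha> \<inter> hs_dom F \<beta> \<inter> hs_dom F \<delta>.
          hs_trans F \<delta> \<alpha> x = germ_comp (hs_trans F \<delta> \<beta> x) (hs_trans F \<beta> \<alpha> x))"

text \<open>For a subspace \<open>X\<close> and its inclusion \<open>h\<close> this is the restriction.\<close>

definition haefliger_pullback ::
  "'a topology \<Rightarrow> ('a \<Rightarrow> 'b) \<Rightarrow> ('i, 'b, 'q::finite) haefliger \<Rightarrow> ('i, 'a, 'q) haefliger" where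
  "haefliger_pullback X h F =
     \<lparr> hs_index = hs_index F,
       hs_dom = (\<lambda>\<alpha>. {x \<in> topspace X. h x \<in> hs_dom F \<alpha>}),
       hs_chart = (\<lambda>\<alpha> x. hs_chart F \<alpha> (h x)),
       hs_trans = (\<lambda>\<beta> \<alpha> x. hs_trans F \<beta> \<alpha> (h x)) \<rparr>"

definition haefliger_refines ::
  "('k, 'a, 'q::finite) haefliger \<Rightarrow> ('i, 'a, 'q) haefliger \<Rightarrow> bool" where
  "haefliger_refines C A \<longleftrightarrow>
     (\<exists>\<rho>. \<forall>k\<in>hs_index C.
        \<rho> k \<in> hs_index A \<and> hs_dom C k \<subseteq> hs_dom A (\<rho> k) \<and>
        (\<forall>x\<in>hs_dom C k. hs_chart C k x = hs_chart A (\<rho> k) x) \<and>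
        (\<forall>l\<in>hs_index C. \<forall>x \<in> hs_dom C k \<inter> hs_dom C l.
           hs_trans C k l x = hs_trans A (\<rho> k) (\<rho> l) x))"

text \<open>
  The index type of the refinement is no restriction: every Haefliger structure on a
  space with points in \<open>'a\<close> has a refinement indexed by the points, obtained by choosing one
  chart at each of them.
\<close>

definition common_refinement ::
  "'a topology \<Rightarrow> ('i, 'a, 'q::finite) haefliger \<Rightarrow> ('j, 'a, 'q) haefliger \<Rightarrow> bool" where
  "common_refinement X A B \<longleftrightarrow>
     haefliger_structure X A \<and> haefliger_structure X B \<and>
     (\<exists>C :: ('a \<times> bool, 'a, 'q) haefliger.
        haefliger_structure X C \<and> haefliger_refines C A \<and> haefliger_refines C B)"

text \<open>
  Having a common refinement is not transitive: for a diffeomorphism \<open>g\<close> with \<open>g \<circ> f \<noteq> f\<close>, the structures given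
  by a single chart \<open>f\<close> and by the single chart \<open>g \<circ> f\<close> have no common refinement, but each of
  them refines the structure with the two charts \<open>f\<close> and \<open>g \<circ> f\<close>.  Equivalence is the
  equivalence relation generated; it is Haefliger's, under which two cocycles are equivalent if
  together they extend to a cocycle on the union of the two covers.  The second component of
  the index type makes room for such a union of two structures indexed by points.
\<close>

definition haefliger_equivalent ::
  "'a topology \<Rightarrow> ('i, 'a, 'q::finite) haefliger \<Rightarrow> ('j, 'a, 'q) haefliger \<Rightarrow> bool" where
  "haefliger_equivalent X A B \<longleftrightarrow>
     (\<exists>(A' :: ('a \<times> bool, 'a, 'q) haefliger) B'.
        common_refinement X A A' \<and> (common_refinement X)\<^sup>*\<^sup>* A' B' \<and> common_refinement X B' B)"

definition normal_cocycle ::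
  "('i, 'a, 'q::finite) haefliger \<Rightarrow> 'i \<Rightarrow> 'i \<Rightarrow> 'a \<Rightarrow> real^'q^'q" where
  "normal_cocycle F \<beta> \<alpha> x = germ_differential (hs_trans F \<beta> \<alpha> x)"

text \<open>
  An orientation of the vector bundle with cover \<open>U\<close> and transition cocycle \<open>g\<close>: an orientation
  of each fibre, varying continuously.  The sign \<open>\<omega> \<alpha> x\<close> compares the orientation of the fibre
  over \<open>x\<close>, read in the trivialization over \<open>U \<alpha>\<close>, with the standard orientation.
\<close>

definition bundle_orientation ::
  "'a topology \<Rightarrow> 'i set \<Rightarrow> ('i \<Rightarrow> 'a set) \<Rightarrow> ('i \<Rightarrow> 'i \<Rightarrow> 'a \<Rightarrow> real^'q^'q) \<Rightarrow>
   ('i \<Rightarrow> 'a \<Rightarrow> real) \<Rightarrow> bool" where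
  "bundle_orientation X I U g \<omega> \<longleftrightarrow>
     (\<forall>\<alpha>\<in>I. continuous_map (subtopology X (U \<alpha>)) (discrete_topology {-1, 1}) (\<omega> \<alpha>)) \<and>
     (\<forall>\<alpha>\<in>I. \<forall>\<beta>\<in>I. \<forall>x \<in> U \<alpha> \<inter> U \<beta>. \<omega> \<beta> x = sgn (det (g \<beta> \<alpha> x)) * \<omega> \<alpha> x)"

definition transverse_orientation ::
  "'a topology \<Rightarrow> ('i, 'a, 'q::finite) haefliger \<Rightarrow> ('i \<Rightarrow> 'a \<Rightarrow> real) \<Rightarrow> bool" where
  "transverse_orientation X F \<omega> \<longleftrightarrow>
     bundle_orientation X (hs_index F) (hs_dom F) (normal_cocycle F) \<omega>"

definition transversely_orientable ::
  "'a topology \<Rightarrow> ('i, 'a, 'q::finite) haefliger \<Rightarrow> bool" where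
  "transversely_orientable X F \<longleftrightarrow> (\<exists>\<omega>. transverse_orientation X F \<omega>)"


section \<open>Surgery and its trace\<close>

text \<open>
  The space obtained from the disjoint union of \<open>X\<close> and \<open>Y\<close> by identifying each \<open>y \<in> A\<close>,
  where \<open>A \<subseteq> topspace Y\<close>, with \<open>h y \<in> topspace X\<close>.  It carries the quotient topology; its
  points are represented by the points of \<open>X\<close> and the points of \<open>Y\<close> outside \<open>A\<close>.
\<close>

definition attach_map :: "'b set \<Rightarrow> ('b \<Rightarrow> 'a) \<Rightarrow> 'b \<Rightarrow> 'a + 'b" where
  "attach_map A h y = (if y \<in> A then Inl (h y) else Inr y)"

definition attach ::
  "'a topology \<Rightarrow> 'b topology \<Rightarrow> 'b set \<Rightarrow> ('b \<Rightarrow> 'a) \<Rightarrow> ('a + 'b) topology" where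
  "attach X Y A h =
     topology (\<lambda>V. V \<subseteq> Inl ` topspace X \<union> Inr ` (topspace Y - A) \<and>
                   openin X {x \<in> topspace X. Inl x \<in> V} \<and>
                   openin Y {y \<in> topspace Y. attach_map A h y \<in> V})"

lemma openin_attach:
  "openin (attach X Y A h) V \<longleftrightarrow>
     V \<subseteq> Inl ` topspace X \<union> Inr ` (topspace Y - A) \<and>
     openin X {x \<in> topspace X. Inl x \<in> V} \<and>
     openin Y {y \<in> topspace Y. attach_map A h y \<in> V}"
proof -
  let ?P = "\<lambda>V. V \<subseteq> Inl ` topspace X \<union> Inr ` (topspace Y - A) \<and>
                openin X {x \<in> topspace X. Inl x \<in> V} \<and>
                openin Y {y \<in> topspace Y. attach_map A h y \<in> V}"
  have "istopology ?P"
    unfolding istopology_def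
  proof (intro conjI allI impI)
    fix S T assume S: "?P S" and T: "?P T"
    have X: "{x \<in> topspace X. Inl x \<in> S \<inter> T} =
            {x \<in> topspace X. Inl x \<in> S} \<inter> {x \<in> topspace X. Inl x \<in> T}"
      and Y: "{y \<in> topspace Y. attach_map A h y \<in> S \<inter> T} =
            {y \<in> topspace Y. attach_map A h y \<in> S} \<inter> {y \<in> topspace Y. attach_map A h y \<in> T}"
      by auto
    show "openin X {x \<in> topspace X. Inl x \<in> S \<inter> T}"
      unfolding X using S T by (intro openin_Int) blast+
    show "openin Y {y \<in> topspace Y. attach_map A h y \<in> S \<inter> T}"
      unfolding Y using S T by (intro openin_Int) blast+
    show "S \<inter> T \<subseteq> Inl ` topspace X \<union> Inr ` (topspace Y - A)"
      using S by blast
  next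
    fix \<K> assume K: "\<forall>K\<in>\<K>. ?P K"
    have X: "{x \<in> topspace X. Inl x \<in> \<Union>\<K>} = (\<Union>K\<in>\<K>. {x \<in> topspace X. Inl x \<in> K})"
      and Y: "{y \<in> topspace Y. attach_map A h y \<in> \<Union>\<K>} =
            (\<Union>K\<in>\<K>. {y \<in> topspace Y. attach_map A h y \<in> K})"
      by auto
    show "openin X {x \<in> topspace X. Inl x \<in> \<Union>\<K>}"
      unfolding X using K by (intro openin_Union) blast
    show "openin Y {y \<in> topspace Y. attach_map A h y \<in> \<Union>\<K>}"
      unfolding Y using K by (intro openin_Union) blast
    show "\<Union>\<K> \<subseteq> Inl ` topspace X \<union> Inr ` (topspace Y - A)"
      using K by blast
  qed
  then show ?thesis
    by (simp add: attach_def)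
qed

lemma topspace_attach:
  assumes "h ` A \<subseteq> topspace X"
  shows "topspace (attach X Y A h) = Inl ` topspace X \<union> Inr ` (topspace Y - A)"
proof -
  let ?V = "Inl ` topspace X \<union> Inr ` (topspace Y - A)"
  have "{x \<in> topspace X. Inl x \<in> ?V} = topspace X"
    "{y \<in> topspace Y. attach_map A h y \<in> ?V} = topspace Y"
    using assms by (auto simp: attach_map_def)
  then have "openin (attach X Y A h) ?V"
    by (simp add: openin_attach)
  then have "?V \<subseteq> topspace (attach X Y A h)"
    by (rule openin_subset)
  moreover have "topspace (attach X Y A h) \<subseteq> ?V"
    using openin_topspace[of "attach X Y A h"] unfolding openin_attach by (rule conjunct1)
  ultimately show ?thesis
    by (rule subset_antisym[rotated])
qed

definition open_part :: "'a topology \<Rightarrow> (real \<times> (real^'n) \<Rightarrow> 'a) \<Rightarrow> 'a topology" where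
  "open_part M \<phi> = subtopology M (topspace M - \<phi> ` (sphere 0 1 \<times> cball 0 1))"

text \<open>
  The point \<open>\<phi> (e, r *\<^sub>R v)\<close>, where \<open>e = \<plusminus>1\<close>, \<open>1 < r < 2\<close> and \<open>v\<close> is a unit vector, is identified
  with the point \<open>(e * r, v)\<close> of the handle.  The removed disc lies in the direction of
  decreasing \<open>r\<close>, the missing end \<open>{e * 2} \<times> S\<^sup>n\<^sup>-\<^sup>1\<close> of the handle in the direction of increasing
  \<open>r\<close>; so the radial coordinates measured from the two ends are \<open>r - 1\<close> and \<open>2 - r\<close>, and the
  identification reverses them.  (Identifying with \<open>(e * (3 - r), v)\<close> instead would give a
  space that is not Hausdorff.)  The part \<open>{-2, 2} \<times> S\<^sup>n\<^sup>-\<^sup>1\<close> of the closed handle is left out: it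
  would be identified with the image of the spheres of radius 2.
\<close>

definition surgered :: "'a topology \<Rightarrow> (real \<times> (real^'n) \<Rightarrow> 'a) \<Rightarrow> ('a + real \<times> (real^'n)) topology" where
  "surgered M \<phi> =
     attach (open_part M \<phi>) (top_of_set (ball 0 2 \<times> sphere 0 1))
       ((ball 0 2 - cball 0 1) \<times> sphere 0 1) (\<lambda>(s, v). \<phi> (sgn s, \<bar>s\<bar> *\<^sub>R v))"

definition surgery_trace ::
  "'a topology \<Rightarrow> (real \<times> (real^'n) \<Rightarrow> 'a) \<Rightarrow> ((real \<times> 'a) + (real \<times> (real^'n))) topology" where
  "surgery_trace M \<phi> =
     attach (prod_topology (top_of_set {0..1}) M) (top_of_set (cball 0 2 \<times> cball 0 2))
       (sphere 0 2 \<times> cball 0 2) (\<lambda>(s, y). (1, \<phi> (sgn s, y)))"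

text \<open>
  The inclusions of the two boundary components into the trace.  The upper component is
  \<open>{1} \<times> (M - \<phi>(S\<^sup>0 \<times> Int 2D\<^sup>n))\<close> together with \<open>2D\<^sup>1 \<times> \<partial>(2D\<^sup>n)\<close>.  The handle \<open>2D\<^sup>1 \<times> S\<^sup>n\<^sup>-\<^sup>1\<close> of the
  surgered manifold goes to the latter by \<open>(s, v) \<mapsto> (s, 2v)\<close>.  The points \<open>\<phi> (e, y)\<close> with
  \<open>1 < |y| < 2\<close> belong to that handle, with coordinates \<open>(e |y|, y / |y|)\<close>.
\<close>

definition trace_lower :: "'a \<Rightarrow> (real \<times> 'a) + (real \<times> (real^'n))" where
  "trace_lower x = Inl (0, x)"

definition trace_upper ::
  "(real \<times> (real^'n) \<Rightarrow> 'a) \<Rightarrow> 'a + real \<times> (real^'n) \<Rightarrow> (real \<times> 'a) + (real \<times> (real^'n))" where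
  "trace_upper \<phi> p =
     (case p of
        Inl x \<Rightarrow>
          if x \<in> \<phi> ` (sphere 0 1 \<times> ball 0 2)
          then (let (e, y) = inv_into (sphere 0 1 \<times> ball 0 2) \<phi> x
                in Inr (e * norm y, (2 / norm y) *\<^sub>R y))
          else Inl (1, x)
      | Inr (s, v) \<Rightarrow> Inr (s, 2 *\<^sub>R v))"


section \<open>Foliation surgery\<close>

text \<open>
  The Haefliger structures on the surgered manifold and on the trace are indexed by the points
  of these spaces.  As for refinements, this is no restriction up to equivalence.
\<close>

definition weak_foliation_surgery ::
  "'a topology \<Rightarrow> ('i, 'a, 'q::finite) haefliger \<Rightarrow> (real \<times> (real^'n) \<Rightarrow> 'a) \<Rightarrow>
   ('a + real \<times> (real^'n), 'a + real \<times> (real^'n), 'q) haefliger \<Rightarrow> bool" where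
  "weak_foliation_surgery M F \<phi> F' \<longleftrightarrow>
     haefliger_structure (surgered M \<phi>) F' \<and>
     haefliger_equivalent (open_part M \<phi>)
       (haefliger_pullback (open_part M \<phi>) Inl F')
       (haefliger_pullback (open_part M \<phi>) (\<lambda>x. x) F)"

definition lax_foliation_surgery ::
  "'a topology \<Rightarrow> ('i, 'a, 'q::finite) haefliger \<Rightarrow> (real \<times> (real^'n) \<Rightarrow> 'a) \<Rightarrow>
   ('a + real \<times> (real^'n), 'a + real \<times> (real^'n), 'q) haefliger \<Rightarrow> bool" where
  "lax_foliation_surgery M F \<phi> F' \<longleftrightarrow>
     haefliger_structure (surgered M \<phi>) F' \<and>
     (\<exists>G :: ((real \<times> 'a) + (real \<times> (real^'n)), (real \<times> 'a) + (real \<times> (real^'n)), 'q) haefliger.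
        haefliger_structure (surgery_trace M \<phi>) G \<and>
        haefliger_equivalent M (haefliger_pullback M trace_lower G) F \<and>
        haefliger_equivalent (surgered M \<phi>)
          (haefliger_pullback (surgered M \<phi>) (trace_upper \<phi>) G) F')"

definition strong_foliation_surgery ::
  "'a topology \<Rightarrow> ('i, 'a, 'q::finite) haefliger \<Rightarrow> (real \<times> (real^'n) \<Rightarrow> 'a) \<Rightarrow>
   ('a + real \<times> (real^'n), 'a + real \<times> (real^'n), 'q) haefliger \<Rightarrow> bool" where
  "strong_foliation_surgery M F \<phi> F' \<longleftrightarrow>
     weak_foliation_surgery M F \<phi> F' \<and> lax_foliation_surgery M F \<phi> F'"

end

theory Submission
  imports Defs
begin

text \<open>
  Let \<open>p\<^sub>\<plusminus> = \<phi> (\<plusminus>1, 0)\<close>.  The trace \<open>W\<close> retracts onto \<open>M\<close> with an arc from \<open>p\<^sub>-\<close> to \<open>p\<^sub>+\<close> attached;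
  the retraction is \<open>(t, x) \<mapsto> x\<close> on the cylinder, and it shrinks the discs \<open>{s} \<times> 2D\<^sup>n\<close> of the
  handle into \<open>\<phi> ({\<plusminus>1} \<times> 2D\<^sup>n)\<close> so that for small \<open>\<bar>s\<bar>\<close> they are constantly \<open>p\<^sub>\<plusminus>\<close>.  On the
  open set where \<open>s \<noteq> 0\<close> we pull \<open>\<F>\<close> back; the part where \<open>\<bar>s\<bar>\<close> is small receives a
  single further chart, constantly \<open>0\<close>, which is glued to charts of \<open>\<F>\<close> at \<open>p\<^sub>\<plusminus>\<close> by affine
  germs.  This is possible because all charts involved are constant there.  The structure
  restricts to \<open>\<F>\<close> on \<open>{0} \<times> M\<close>, and its restriction to \<open>M'\<close> restricts to \<open>\<F>\<close> on the open
  part since the composite of the retraction with the inclusion of \<open>M'\<close> is the identity there.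
  Composing one of the two affine germs with a reflection, if necessary, makes the
  orientations agree.
\<close>

section \<open>Conjugation of germs by affine involutions\<close>

text \<open>The coordinate changes below are \<open>x \<mapsto> A (x - c)\<close>. For a linear
  involution the inverse is \<open>y \<mapsto> A y + c\<close>, so no second map has to be carried
  along. The instances in use are the identity and a reflection.\<close>

definition involution :: "('a::euclidean_space \<Rightarrow> 'a) \<Rightarrow> bool" where
  "involution A \<longleftrightarrow> linear A \<and> (\<forall>x. A (A x) = x)"

lemma involution_id: "involution (\<lambda>x. x)"
  by (simp add: involution_def linear_iff)

lemma
  assumes "involution A"
  shows involution_linear: "linear A"
    and involution_bounded_linear: "bounded_linear A"
    and involution_involution: "A (A x) = x"
  using assms by (auto simp: involution_def linear_conv_bounded_linear)

lemma image_affine_involution: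
  assumes "involution B"
  shows "(\<lambda>x. B (x - d)) ` S = (\<lambda>y. B y + d) -` S"
  using assms by (force simp: involution_involution intro: rev_image_eqI)

lemma continuous_affine_involution:
  assumes "involution B"
  shows "continuous_on S (\<lambda>y. B y + d)"
  by (intro continuous_intros bounded_linear.continuous_on[OF involution_bounded_linear[OF assms]])

lemma open_image_affine_involution:
  assumes "involution B" "open S"
  shows "open ((\<lambda>x. B (x - d)) ` S)"
  unfolding image_affine_involution[OF assms(1)]
  by (rule open_vimage[OF assms(2) continuous_affine_involution[OF assms(1)]])

section \<open>Smoothness under affine changes of coordinates\<close>

lemma C_k_on_cong:
  assumes "C_k_on k S f" "open S" "\<And>x. x \<in> S \<Longrightarrow> f x = g x"
  shows "C_k_on k S g"
  using assms
proof (induction k arbitrary: f g)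
  case 0
  then show ?case by (auto cong: continuous_on_cong)
next
  case (Suc k)
  have ev: "\<forall>\<^sub>F y in nhds x. f y = g y" if "x \<in> S" for x
    using Suc.prems that by (auto simp: eventually_nhds)
  \<comment> \<open>As \<open>S\<close> is open, agreement on \<open>S\<close> transfers derivatives
    at its points. Hence the directional derivatives agree on \<open>S\<close> too, and the
    induction hypothesis applies to them.\<close>
  have D: "(g has_derivative D) (at x)" if "(f has_derivative D) (at x)" "x \<in> S" for x D
    using has_derivative_transform_within_open[OF that(1) Suc.prems(2) that(2)] Suc.prems(3) by blast
  have diff: "f differentiable (at x)" if "x \<in> S" for x
    using Suc.prems(1) that by simp
  have eq: "frechet_derivative f (at x) = frechet_derivative g (at x)" if "x \<in> S" for x
    using frechet_derivative_at[OF D] diff[OF that] that by (simp add: frechet_derivative_works)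
  show ?case
    unfolding C_k_on.simps
  proof (intro conjI ballI allI)
    show "g differentiable (at x)" if "x \<in> S" for x
      using diff[OF that] D[OF _ that] by (auto simp: differentiable_def)
    show "C_k_on k S (\<lambda>x. frechet_derivative g (at x) v)" for v
      by (rule Suc.IH[of "\<lambda>x. frechet_derivative f (at x) v"]) (use Suc.prems eq in auto)
  qed
qed

lemma has_derivative_affine_involution_conj:
  assumes "involution A" "involution B" "(f has_derivative D) (at (B y + d))"
  shows "((\<lambda>y. A (f (B y + d) - c)) has_derivative (\<lambda>v. A (D (B v)))) (at y)"
proof -
  have B: "((\<lambda>y. B y + d) has_derivative B) (at y)"
    using bounded_linear.has_derivative[OF involution_bounded_linear[OF assms(2)] has_derivative_ident]
    by (auto intro!: derivative_eq_intros)
  have "((\<lambda>y. f (B y + d)) has_derivative (\<lambda>v. D (B v))) (at y)"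
    using has_derivative_compose[OF B assms(3)] .
  then have "((\<lambda>y. f (B y + d) - c) has_derivative (\<lambda>v. D (B v))) (at y)"
    by (auto intro!: derivative_eq_intros)
  then show ?thesis
    by (rule bounded_linear.has_derivative[OF involution_bounded_linear[OF assms(1)]])
qed

text \<open>The derivative of the conjugate in direction \<open>v\<close> is \<open>A\<close>
  applied to the derivative of \<open>f\<close> in direction \<open>B v\<close>: again a conjugate,
  now with \<open>c = 0\<close>. Hence the induction leaves \<open>f\<close> and \<open>c\<close>
  arbitrary.\<close>

lemma C_k_on_affine_involution_conj:
  assumes "involution A" "involution B" "open S" "C_k_on k S f"
  shows "C_k_on k ((\<lambda>x. B (x - d)) ` S) (\<lambda>y. A (f (B y + d) - c))"
  using assms(4)
proof (induction k arbitrary: f c)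
  case 0
  have "continuous_on ((\<lambda>x. B (x - d)) ` S) (\<lambda>y. f (B y + d))"
    by (rule continuous_on_compose2[OF _ continuous_affine_involution[OF assms(2)]])
       (use 0 assms(2) in \<open>auto simp: involution_involution\<close>)
  then show ?case
    by (auto intro!: continuous_intros bounded_linear.continuous_on[OF involution_bounded_linear[OF assms(1)]])
next
  case (Suc k)
  let ?S = "(\<lambda>x. B (x - d)) ` S" and ?f = "\<lambda>y. A (f (B y + d) - c)"
  have mem: "B y + d \<in> S" if "y \<in> ?S" for y
    using that assms(2) by (auto simp: involution_involution)
  have D: "(?f has_derivative (\<lambda>v. A (frechet_derivative f (at (B y + d)) (B v)))) (at y)" if "y \<in> ?S" for y
    using Suc.prems mem[OF that]
    by (intro has_derivative_affine_involution_conj assms) (auto simp: frechet_derivative_works)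
  have "C_k_on k ?S (\<lambda>y. frechet_derivative ?f (at y) v)" for v
  proof (rule C_k_on_cong)
    show "C_k_on k ?S (\<lambda>y. A (frechet_derivative f (at (B y + d)) (B v) - 0))"
      using Suc.prems by (intro Suc.IH) simp
    show "open ?S" by (rule open_image_affine_involution[OF assms(2,3)])
  qed (simp add: fun_cong[OF frechet_derivative_at[OF D]])
  with D show ?case by (auto simp: differentiable_def)
qed

text \<open>The inverse of the conjugate is the conjugate of the inverse, with \<open>(A, c)\<close>
  and \<open>(B, d)\<close> exchanged, so one smoothness lemma serves both directions.\<close>

lemma local_diffeo_affine_involution_conj:
  assumes "involution A" "involution B" "local_diffeo V g"
  shows "local_diffeo ((\<lambda>x. B (x - d)) ` V) (\<lambda>y. A (g (B y + d) - c))"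
proof -
  let ?V = "(\<lambda>x. B (x - d)) ` V" and ?g = "\<lambda>y. A (g (B y + d) - c)"
  have V: "open V" "open (g ` V)" "inj_on g V"
    and s: "smooth_on V g" "smooth_on (g ` V) (inv_into V g)"
    using assms(3) by (auto simp: local_diffeo_def)
  have im: "?g ` ?V = (\<lambda>x. A (x - c)) ` (g ` V)"
    using assms(2) by (auto simp: image_image involution_involution)
  have inj: "inj_on ?g ?V"
  proof (rule inj_onI, clarify)
    fix x y assume xy: "x \<in> V" "y \<in> V" "A (g (B (B (x - d)) + d) - c) = A (g (B (B (y - d)) + d) - c)"
    from this(3) have "g x = g y"
      using assms(1,2) by (metis diff_add_cancel involution_involution)
    then show "B (x - d) = B (y - d)" using V xy by (auto dest: inj_onD)
  qed
  have inv: "B (inv_into V g (A z + c) - d) = inv_into ?V ?g z" if "z \<in> ?g ` ?V" for z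
  proof -
    from that obtain x where x: "x \<in> V" "z = A (g x - c)" unfolding im by auto
    have "inv_into ?V ?g (?g (B (x - d))) = B (x - d)"
      using x by (intro inv_into_f_f[OF inj]) auto
    then show ?thesis
      using assms(1,2) x V by (simp add: involution_involution)
  qed
  have "smooth_on (?g ` ?V) (inv_into ?V ?g)"
    unfolding smooth_on_def
  proof
    fix k
    have "C_k_on k (?g ` ?V) (\<lambda>z. B (inv_into V g (A z + c) - d))"
      unfolding im using s assms V by (intro C_k_on_affine_involution_conj) (auto simp: smooth_on_def)
    then show "C_k_on k (?g ` ?V) (inv_into ?V ?g)"
      by (rule C_k_on_cong)
         (use inv V assms in \<open>auto simp only: im intro!: open_image_affine_involution\<close>)
  qed
  moreover have "smooth_on ?V ?g"
    using s assms V by (auto simp: smooth_on_def intro!: C_k_on_affine_involution_conj)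
  ultimately show ?thesis
    using inj V assms by (auto simp: local_diffeo_def im intro!: open_image_affine_involution)
qed

section \<open>Germs and their representatives\<close>

lemma local_diffeo_isCont:
  assumes "local_diffeo V g" "x \<in> V"
  shows "isCont g x"
proof -
  have "C_k_on 0 V g" "open V" using assms by (auto simp: local_diffeo_def smooth_on_def)
  then show ?thesis using assms(2) by (simp add: continuous_on_eq_continuous_at)
qed

lemma local_diffeo_differentiable:
  assumes "local_diffeo V g" "x \<in> V"
  shows "g differentiable (at x)"
proof -
  have "C_k_on (Suc 0) V g" using assms by (auto simp only: local_diffeo_def smooth_on_def)
  then show ?thesis using assms(2) by simp
qed

lemma fst_germ [simp]: "fst (germ g x) = x"
  by (simp add: germ_def)

lemma germ_mem_iff: "h \<in> snd (germ g x) \<longleftrightarrow> (\<forall>\<^sub>F y in nhds x. h y = g y)"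
  by (simp add: germ_def)

lemma germ_mem [simp]: "g \<in> snd (germ g x)"
  by (simp add: germ_mem_iff)

lemma germ_cong:
  assumes "\<forall>\<^sub>F y in nhds x. g y = h y"
  shows "germ g x = germ h x"
proof -
  have "(\<forall>\<^sub>F y in nhds x. k y = g y) \<longleftrightarrow> (\<forall>\<^sub>F y in nhds x. k y = h y)" for k
    using assms by (auto elim: eventually_elim2)
  then show ?thesis by (simp add: germ_def)
qed

lemma topspace_Gamma_iff:
  "a \<in> topspace Gamma \<longleftrightarrow> (\<exists>V g x. local_diffeo V g \<and> x \<in> V \<and> a = germ g x)"
  unfolding Gamma_def topology_generated_by_topspace by auto

lemma isCont_filterlim_nhds:
  assumes "isCont g x" "g x = y"
  shows "filterlim g (nhds y) (nhds x)"
  using assms by (metis isCont_def tendsto_at_iff_tendsto_nhds)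

text \<open>\<open>germ_comp\<close> admits all representatives of both germs. Continuity of
  \<open>g\<close> at \<open>x\<close> pulls a neighbourhood of \<open>y\<close> back to one of
  \<open>x\<close>, so all these composites have the same germ.\<close>

lemma germ_comp_germ:
  assumes "isCont g x" "y = g x"
  shows "germ_comp (germ k y) (germ g x) = germ (\<lambda>z. k (g z)) x"
proof -
  have *: "\<forall>\<^sub>F z in nhds x. k' (g' z) = k (g z)"
    if "\<forall>\<^sub>F z in nhds x. g' z = g z" "\<forall>\<^sub>F w in nhds y. k' w = k w" for g' k'
  proof -
    have "filterlim g (nhds y) (nhds x)"
      using assms by (simp add: isCont_filterlim_nhds)
    then have "\<forall>\<^sub>F z in nhds x. k' (g z) = k (g z)"
      using that(2) unfolding filterlim_iff by blast
    with that(1) show ?thesis by eventually_elim simp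
  qed
  have "(\<exists>g'\<in>snd (germ g x). \<exists>k'\<in>snd (germ k y). \<forall>\<^sub>F z in nhds x. h z = k' (g' z)) \<longleftrightarrow>
        (\<forall>\<^sub>F z in nhds x. h z = k (g z))" for h
  proof
    assume "\<exists>g'\<in>snd (germ g x). \<exists>k'\<in>snd (germ k y). \<forall>\<^sub>F z in nhds x. h z = k' (g' z)"
    then obtain g' k' where h: "\<forall>\<^sub>F z in nhds x. h z = k' (g' z)"
      and "g' \<in> snd (germ g x)" "k' \<in> snd (germ k y)" by blast
    then have "\<forall>\<^sub>F z in nhds x. k' (g' z) = k (g z)"
      unfolding germ_mem_iff by (intro *)
    with h show "\<forall>\<^sub>F z in nhds x. h z = k (g z)" by eventually_elim simp
  qed (use germ_mem in blast)
  then show ?thesis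
    by (simp add: germ_comp_def) (simp add: germ_def)
qed

text \<open>
  The composite of the germ \<open>a\<close> with the affine maps \<open>x \<mapsto> A (x - c)\<close> on the left and
  \<open>y \<mapsto> B y + d\<close>, the inverse of \<open>x \<mapsto> B (x - d)\<close>, on the right.
\<close>

definition germ_conj ::
  "(real^'q \<Rightarrow> real^'q) \<Rightarrow> real^'q \<Rightarrow> (real^'q \<Rightarrow> real^'q) \<Rightarrow> real^'q \<Rightarrow> 'q::finite germ \<Rightarrow> 'q germ"
  where "germ_conj A c B d a =
    germ (\<lambda>y. A ((SOME g. g \<in> snd a) (B y + d) - c)) (B (fst a - d))"

lemma germ_some: "\<forall>\<^sub>F y in nhds x. (SOME h. h \<in> snd (germ g x)) y = g y"
  using someI[of "\<lambda>h. h \<in> snd (germ g x)", OF germ_mem] by (simp add: germ_mem_iff)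

text \<open>The representative picked in \<open>germ_conj\<close> does not matter: it agrees with
  \<open>g\<close> near \<open>x\<close>, and \<open>B y + d\<close> tends to \<open>x\<close> as
  \<open>y\<close> tends to \<open>B (x - d)\<close>.\<close>

lemma germ_conj_germ:
  assumes "involution B"
  shows "germ_conj A c B d (germ g x) = germ (\<lambda>y. A (g (B y + d) - c)) (B (x - d))"
proof -
  have "isCont (\<lambda>y. B y + d) (B (x - d))"
    using continuous_affine_involution[OF assms, of UNIV d] by (simp add: continuous_on_eq_continuous_at)
  then have "filterlim (\<lambda>y. B y + d) (nhds x) (nhds (B (x - d)))"
    by (rule isCont_filterlim_nhds) (simp add: involution_involution[OF assms])
  then have "\<forall>\<^sub>F y in nhds (B (x - d)). (SOME h. h \<in> snd (germ g x)) (B y + d) = g (B y + d)"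
    using germ_some[of g x] unfolding filterlim_iff by blast
  then show ?thesis
    unfolding germ_conj_def fst_germ by (intro germ_cong) (auto elim: eventually_mono)
qed

lemma germ_conj_id:
  assumes "a \<in> topspace Gamma"
  shows "germ_conj (\<lambda>x. x) 0 (\<lambda>x. x) 0 a = a"
  using assms unfolding topspace_Gamma_iff by (auto simp: germ_conj_germ[OF involution_id])

lemma germ_conj_in_Gamma:
  assumes "involution A" "involution B" "a \<in> topspace Gamma"
  shows "germ_conj A c B d a \<in> topspace Gamma"
proof -
  obtain V g x where g: "local_diffeo V g" "x \<in> V" "a = germ g x"
    using assms(3) by (auto simp: topspace_Gamma_iff)
  have "local_diffeo ((\<lambda>x. B (x - d)) ` V) (\<lambda>y. A (g (B y + d) - c))"
    using local_diffeo_affine_involution_conj[OF assms(1,2) g(1)] .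
  moreover have "germ_conj A c B d a = germ (\<lambda>y. A (g (B y + d) - c)) (B (x - d))"
    unfolding g(3) by (rule germ_conj_germ[OF assms(2)])
  ultimately show ?thesis
    using g(2) unfolding topspace_Gamma_iff by blast
qed

text \<open>The inner coordinate changes by \<open>B\<close> and \<open>d\<close> cancel. This
  carries the cocycle condition over to conjugated transition germs;
  \<open>fst b = g (fst a)\<close> says that the germs are composable.\<close>

lemma germ_conj_comp:
  assumes "involution A" "involution B" "involution C"
    and b: "b \<in> topspace Gamma" and a: "a \<in> topspace Gamma" "g \<in> snd a" "fst b = g (fst a)"
  shows "germ_comp (germ_conj A c B d b) (germ_conj B d C e a) = germ_conj A c C e (germ_comp b a)"
proof -
  obtain k y where k: "b = germ k y" using b by (auto simp: topspace_Gamma_iff)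
  obtain V h x where h: "local_diffeo V h" "x \<in> V" "a = germ h x"
    using a(1) by (auto simp: topspace_Gamma_iff)
  have y: "y = h x"
    using a(2,3) unfolding h k germ_mem_iff by (auto dest: eventually_nhds_x_imp_x)
  let ?h = "\<lambda>z. B (h (C z + e) - d)"
  have "local_diffeo ((\<lambda>x. C (x - e)) ` V) ?h"
    using local_diffeo_affine_involution_conj[OF assms(2,3) h(1)] .
  then have cont: "isCont ?h (C (x - e))"
    using h(2) by (blast intro: local_diffeo_isCont)
  have "B (y - d) = ?h (C (x - e))"
    using assms y by (simp add: involution_involution)
  from germ_comp_germ[OF cont this] germ_comp_germ[OF local_diffeo_isCont[OF h(1,2)] y]
  show ?thesis
    unfolding h k using assms by (simp add: germ_conj_germ involution_involution)
qed

section \<open>Differentials, idempotent germs and a reflection\<close>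

lemma germ_differential_germ:
  assumes "(g has_derivative D) (at x)"
  shows "germ_differential (germ g x) = matrix D"
proof -
  let ?h = "SOME h. h \<in> snd (germ g x)"
  have "(?h has_derivative D) (at x)"
  proof (rule has_derivative_transform_eventually[OF assms])
    have "\<forall>\<^sub>F y in nhds x. g y = ?h y"
      using germ_some[of g x] by (rule eventually_mono) simp
    then show "\<forall>\<^sub>F y in at x. g y = ?h y" "g x = ?h x"
      by (auto dest: eventually_nhds_x_imp_x simp: eventually_at_filter elim: eventually_mono)
  qed simp
  then show ?thesis
    unfolding germ_differential_def fst_germ by (simp add: frechet_derivative_at[symmetric])
qed

lemma det_germ_differential_conj:
  assumes "involution A" "involution B" "a \<in> topspace Gamma"
  shows "det (germ_differential (germ_conj A c B d a)) =
    det (matrix A) * det (germ_differential a) * det (matrix B)"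
proof -
  obtain V g x where g: "local_diffeo V g" "x \<in> V" "a = germ g x"
    using assms(3) by (auto simp: topspace_Gamma_iff)
  obtain D where D: "(g has_derivative D) (at x)"
    using local_diffeo_differentiable[OF g(1,2)] by (auto simp: differentiable_def)
  then have lin: "linear D" by (rule has_derivative_linear)
  have "((\<lambda>y. A (g (B y + d) - c)) has_derivative (\<lambda>v. A (D (B v)))) (at (B (x - d)))"
    by (rule has_derivative_affine_involution_conj[OF assms(1,2)])
       (use D assms(2) in \<open>simp add: involution_involution\<close>)
  then have "germ_differential (germ_conj A c B d a) = matrix (A \<circ> (D \<circ> B))"
    unfolding g germ_conj_germ[OF assms(2)] by (subst germ_differential_germ) (auto simp: o_def)
  also have "\<dots> = matrix A ** (matrix D ** matrix B)"
    using assms lin involution_linear by (metis linear_compose matrix_compose)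
  finally show ?thesis
    using germ_differential_germ[OF D] by (simp add: det_mul g)
qed

text \<open>If \<open>g\<close> is injective near its fixed point \<open>x\<close> and
  \<open>g (g y) = g y\<close> near \<open>x\<close>, then \<open>g y = y\<close> there. This will
  identify the transition germ from a chart to itself.\<close>

lemma idempotent_germ:
  assumes a: "a \<in> topspace Gamma" "germ_comp a a = a" and k: "k \<in> snd a" "k (fst a) = fst a"
  shows "a = germ (\<lambda>x. x) (fst a)"
proof -
  obtain V g x where g: "local_diffeo V g" "x \<in> V" "a = germ g x"
    using a(1) by (auto simp: topspace_Gamma_iff)
  have V: "open V" "inj_on g V" using g by (auto simp: local_diffeo_def)
  have gx: "g x = x"
    using k unfolding g germ_mem_iff by (auto dest: eventually_nhds_x_imp_x)
  have cont: "filterlim g (nhds x) (nhds x)"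
    using local_diffeo_isCont[OF g(1,2)] gx by (rule isCont_filterlim_nhds)
  have "g \<in> snd (germ (\<lambda>z. g (g z)) x)"
    using germ_comp_germ[OF local_diffeo_isCont[OF g(1,2)], of x g] a(2) gx g(3) germ_mem by metis
  then have "\<forall>\<^sub>F y in nhds x. g y = g (g y)" by (simp add: germ_mem_iff)
  moreover have V': "\<forall>\<^sub>F y in nhds x. y \<in> V" using V g by (auto simp: eventually_nhds)
  moreover have "\<forall>\<^sub>F y in nhds x. g y \<in> V" using cont V' unfolding filterlim_iff by blast
  ultimately have "\<forall>\<^sub>F y in nhds x. g y = y"
    by eventually_elim (use V in \<open>auto dest: inj_onD\<close>)
  then show ?thesis unfolding g by (simp add: germ_cong)
qed

text \<open>Changing the sign of one coordinate gives a diagonal matrix with a single entry -1. This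
  map serves to reverse a transverse orientation.\<close>

lemma reflection_exists:
  "\<exists>A :: real^'q \<Rightarrow> real^'q::finite. involution A \<and> det (matrix A) = -1"
proof -
  fix i :: 'q
  let ?A = "\<lambda>x :: real^'q. \<chi> j. if j = i then - x $ j else x $ j"
  have lin: "linear ?A" by (rule linearI) (auto simp: vec_eq_iff)
  have "matrix ?A $ k $ l = 0" if "k \<noteq> l" for k l
    using that by (simp add: matrix_def axis_def)
  then have "det (matrix ?A) = (\<Prod>j\<in>UNIV. matrix ?A $ j $ j)" by (rule det_diagonal)
  also have "\<dots> = (\<Prod>j\<in>UNIV. if j = i then -1 else 1)"
    by (rule prod.cong) (auto simp: matrix_def axis_def)
  also have "\<dots> = -1" by simp
  finally have "det (matrix ?A) = -1" .
  moreover have "involution ?A" using lin by (simp add: involution_def vec_eq_iff)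
  ultimately show ?thesis by blast
qed

section \<open>Pullbacks, refinements and orientations\<close>

lemma
  assumes "haefliger_structure X F"
  shows hs_dom_open: "\<alpha> \<in> hs_index F \<Longrightarrow> openin X (hs_dom F \<alpha>)"
    and hs_cover: "(\<Union>\<alpha>\<in>hs_index F. hs_dom F \<alpha>) = topspace X"
    and hs_chart_continuous:
      "\<alpha> \<in> hs_index F \<Longrightarrow> continuous_map (subtopology X (hs_dom F \<alpha>)) euclidean (hs_chart F \<alpha>)"
    and hs_trans_continuous: "\<alpha> \<in> hs_index F \<Longrightarrow> \<beta> \<in> hs_index F \<Longrightarrow>
      continuous_map (subtopology X (hs_dom F \<alpha> \<inter> hs_dom F \<beta>)) Gamma (hs_trans F \<beta> \<alpha>)"
    and hs_trans_carries: "\<alpha> \<in> hs_index F \<Longrightarrow> \<beta> \<in> hs_index F \<Longrightarrow> x \<in> hs_dom F \<alpha> \<Longrightarrow> x \<in> hs_dom F \<beta> \<Longrightarrow>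
      germ_carries X (hs_trans F \<beta> \<alpha> x) (hs_chart F \<alpha>) (hs_chart F \<beta>) x"
    and hs_cocycle: "\<alpha> \<in> hs_index F \<Longrightarrow> \<beta> \<in> hs_index F \<Longrightarrow> \<delta> \<in> hs_index F \<Longrightarrow>
      x \<in> hs_dom F \<alpha> \<Longrightarrow> x \<in> hs_dom F \<beta> \<Longrightarrow> x \<in> hs_dom F \<delta> \<Longrightarrow>
      hs_trans F \<delta> \<alpha> x = germ_comp (hs_trans F \<delta> \<beta> x) (hs_trans F \<beta> \<alpha> x)"
proof -
  note H = assms[unfolded haefliger_structure_def]
  note H2 = H[THEN conjunct2] note H3 = H2[THEN conjunct2] note H4 = H3[THEN conjunct2]
  show "\<alpha> \<in> hs_index F \<Longrightarrow> openin X (hs_dom F \<alpha>)"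
    by (rule H[THEN conjunct1, rule_format])
  show "(\<Union>\<alpha>\<in>hs_index F. hs_dom F \<alpha>) = topspace X"
    by (rule H2[THEN conjunct1])
  show "\<alpha> \<in> hs_index F \<Longrightarrow> continuous_map (subtopology X (hs_dom F \<alpha>)) euclidean (hs_chart F \<alpha>)"
    by (rule H3[THEN conjunct1, rule_format])
  show "\<alpha> \<in> hs_index F \<Longrightarrow> \<beta> \<in> hs_index F \<Longrightarrow>
      continuous_map (subtopology X (hs_dom F \<alpha> \<inter> hs_dom F \<beta>)) Gamma (hs_trans F \<beta> \<alpha>)"
    by (rule H4[THEN conjunct1, rule_format, THEN conjunct1])
  show "\<alpha> \<in> hs_index F \<Longrightarrow> \<beta> \<in> hs_index F \<Longrightarrow> x \<in> hs_dom F \<alpha> \<Longrightarrow> x \<in> hs_dom F \<beta> \<Longrightarrow>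
      germ_carries X (hs_trans F \<beta> \<alpha> x) (hs_chart F \<alpha>) (hs_chart F \<beta>) x"
    by (rule H4[THEN conjunct1, rule_format, THEN conjunct2, rule_format]) auto
  show "\<alpha> \<in> hs_index F \<Longrightarrow> \<beta> \<in> hs_index F \<Longrightarrow> \<delta> \<in> hs_index F \<Longrightarrow>
      x \<in> hs_dom F \<alpha> \<Longrightarrow> x \<in> hs_dom F \<beta> \<Longrightarrow> x \<in> hs_dom F \<delta> \<Longrightarrow>
      hs_trans F \<delta> \<alpha> x = germ_comp (hs_trans F \<delta> \<beta> x) (hs_trans F \<beta> \<alpha> x)"
    by (rule H4[THEN conjunct2, rule_format]) auto
qed

lemma hs_trans_in_Gamma:
  assumes "haefliger_structure X F" "\<alpha> \<in> hs_index F" "\<beta> \<in> hs_index F" "x \<in> hs_dom F \<alpha>" "x \<in> hs_dom F \<beta>"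
  shows "hs_trans F \<beta> \<alpha> x \<in> topspace Gamma"
proof -
  have "x \<in> topspace X" using hs_dom_open[OF assms(1,2)] assms(4) by (auto dest: openin_subset)
  then show ?thesis
    using continuous_map_funspace[OF hs_trans_continuous[OF assms(1-3)]] assms(4,5) by auto
qed

lemma hs_trans_value:
  assumes "haefliger_structure X F" "\<alpha> \<in> hs_index F" "\<beta> \<in> hs_index F" "x \<in> hs_dom F \<alpha>" "x \<in> hs_dom F \<beta>"
  obtains g where "g \<in> snd (hs_trans F \<beta> \<alpha> x)" "fst (hs_trans F \<beta> \<alpha> x) = hs_chart F \<alpha> x"
    "hs_chart F \<beta> x = g (hs_chart F \<alpha> x)"
  using hs_trans_carries[OF assms] unfolding germ_carries_def by blast

text \<open>The cocycle condition with three equal indices makes the germ idempotent, and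
  \<open>germ_carries\<close> makes it fix the value of the chart.\<close>

lemma hs_trans_self:
  assumes "haefliger_structure X F" "\<alpha> \<in> hs_index F" "x \<in> hs_dom F \<alpha>"
  shows "hs_trans F \<alpha> \<alpha> x = germ (\<lambda>y. y) (hs_chart F \<alpha> x)"
proof -
  obtain g where "g \<in> snd (hs_trans F \<alpha> \<alpha> x)" "fst (hs_trans F \<alpha> \<alpha> x) = hs_chart F \<alpha> x"
    "hs_chart F \<alpha> x = g (hs_chart F \<alpha> x)"
    using hs_trans_value[OF assms(1,2,2,3,3)] .
  then show ?thesis
    using idempotent_germ[OF hs_trans_in_Gamma[OF assms(1,2,2,3,3)] hs_cocycle[OF assms(1,2,2,2,3,3,3), symmetric]]
    by metis
qed

section \<open>Pullbacks along continuous maps\<close>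

lemma haefliger_pullback_sel [simp]:
  "hs_index (haefliger_pullback X h F) = hs_index F"
  "hs_dom (haefliger_pullback X h F) \<alpha> = {x \<in> topspace X. h x \<in> hs_dom F \<alpha>}"
  "hs_chart (haefliger_pullback X h F) \<alpha> = (\<lambda>x. hs_chart F \<alpha> (h x))"
  "hs_trans (haefliger_pullback X h F) \<beta> \<alpha> = (\<lambda>x. hs_trans F \<beta> \<alpha> (h x))"
  by (simp_all add: haefliger_pullback_def)

lemma haefliger_structure_pullback:
  assumes F: "haefliger_structure Y F" and h: "continuous_map X Y h"
  shows "haefliger_structure X (haefliger_pullback X h F)"
proof -
  have sub: "continuous_map (subtopology X {x \<in> topspace X. h x \<in> S}) (subtopology Y S) h" for S
    using h by (auto simp: continuous_map_in_subtopology continuous_map_from_subtopology)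
  have Int: "{x \<in> topspace X. h x \<in> S} \<inter> {x \<in> topspace X. h x \<in> T} = {x \<in> topspace X. h x \<in> S \<inter> T}" for S T
    by auto
  have "germ_carries X a (\<lambda>x. f (h x)) (\<lambda>x. f' (h x)) x"
    if "germ_carries Y a f f' (h x)" "x \<in> topspace X" for a f f' x
  proof -
    from that(1) obtain g N where "g \<in> snd a" "openin Y N" "h x \<in> N" "\<forall>y\<in>N. f' y = g (f y)" "fst a = f (h x)"
      unfolding germ_carries_def by blast
    then show ?thesis
      using openin_continuous_map_preimage[OF h] that(2) unfolding germ_carries_def
      by (intro conjI bexI[of _ g] exI[of _ "{x \<in> topspace X. h x \<in> N}"]) auto
  qed
  note carries = this
  have cover: "(\<Union>\<alpha>\<in>hs_index F. {x \<in> topspace X. h x \<in> hs_dom F \<alpha>}) = topspace X"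
    using continuous_map_funspace[OF h] hs_cover[OF F] by (auto simp: Pi_iff)
  show ?thesis
    unfolding haefliger_structure_def haefliger_pullback_sel Int
  proof (intro conjI ballI cover)
    fix \<alpha> \<beta> assume i: "\<alpha> \<in> hs_index F" "\<beta> \<in> hs_index F"
    show "continuous_map (subtopology X {x \<in> topspace X. h x \<in> hs_dom F \<alpha> \<inter> hs_dom F \<beta>}) Gamma
        (\<lambda>x. hs_trans F \<beta> \<alpha> (h x))"
      using continuous_map_compose[OF sub hs_trans_continuous[OF F i]] by (simp add: o_def)
    show "germ_carries X (hs_trans F \<beta> \<alpha> (h x)) (\<lambda>x. hs_chart F \<alpha> (h x)) (\<lambda>x. hs_chart F \<beta> (h x)) x"
      if "x \<in> {x \<in> topspace X. h x \<in> hs_dom F \<alpha> \<inter> hs_dom F \<beta>}" for x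
      by (rule carries) (use that in \<open>auto intro: hs_trans_carries[OF F i]\<close>)
  next
    fix \<alpha> assume i: "\<alpha> \<in> hs_index F"
    show "openin X {x \<in> topspace X. h x \<in> hs_dom F \<alpha>}"
      by (rule openin_continuous_map_preimage[OF h hs_dom_open[OF F i]])
    show "continuous_map (subtopology X {x \<in> topspace X. h x \<in> hs_dom F \<alpha>}) euclidean
        (\<lambda>x. hs_chart F \<alpha> (h x))"
      using continuous_map_compose[OF sub hs_chart_continuous[OF F i]] by (simp add: o_def)
  next
    fix \<alpha> \<beta> \<delta> x
    assume "\<alpha> \<in> hs_index F" "\<beta> \<in> hs_index F" "\<delta> \<in> hs_index F"
      and "x \<in> {x \<in> topspace X. h x \<in> hs_dom F \<alpha> \<inter> hs_dom F \<beta> \<inter> hs_dom F \<delta>}"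
    then show "hs_trans F \<delta> \<alpha> (h x) = germ_comp (hs_trans F \<delta> \<beta> (h x)) (hs_trans F \<beta> \<alpha> (h x))"
      by (intro hs_cocycle[OF F]) auto
  qed
qed

text \<open>An equality of records, not only an equivalence. The hypothesis on \<open>h\<close>
  absorbs the condition \<open>h x \<in> topspace Y\<close> from the domains of the inner
  pullback.\<close>

lemma haefliger_pullback_pullback:
  assumes "h \<in> topspace X \<rightarrow> topspace Y"
  shows "haefliger_pullback X h (haefliger_pullback Y k F) = haefliger_pullback X (\<lambda>x. k (h x)) F"
  using assms by (auto simp: haefliger_pullback_def fun_eq_iff)

section \<open>Refinements and changes of the index set\<close>

definition haefliger_refines_via ::
  "('k \<Rightarrow> 'i) \<Rightarrow> ('k, 'a, 'q::finite) haefliger \<Rightarrow> ('i, 'a, 'q) haefliger \<Rightarrow> bool" where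
  "haefliger_refines_via \<rho> C A \<longleftrightarrow> (\<forall>k\<in>hs_index C.
     \<rho> k \<in> hs_index A \<and> hs_dom C k \<subseteq> hs_dom A (\<rho> k) \<and>
     (\<forall>x\<in>hs_dom C k. hs_chart C k x = hs_chart A (\<rho> k) x) \<and>
     (\<forall>l\<in>hs_index C. \<forall>x \<in> hs_dom C k \<inter> hs_dom C l.
        hs_trans C k l x = hs_trans A (\<rho> k) (\<rho> l) x))"

lemma haefliger_refines_iff: "haefliger_refines C A \<longleftrightarrow> (\<exists>\<rho>. haefliger_refines_via \<rho> C A)"
  unfolding haefliger_refines_def haefliger_refines_via_def by (rule refl)

lemma
  assumes "haefliger_refines_via \<rho> C A" "k \<in> hs_index C"
  shows refines_via_index: "\<rho> k \<in> hs_index A"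
    and refines_via_dom: "x \<in> hs_dom C k \<Longrightarrow> x \<in> hs_dom A (\<rho> k)"
    and refines_via_chart: "x \<in> hs_dom C k \<Longrightarrow> hs_chart C k x = hs_chart A (\<rho> k) x"
    and refines_via_trans: "l \<in> hs_index C \<Longrightarrow> x \<in> hs_dom C k \<Longrightarrow> x \<in> hs_dom C l \<Longrightarrow>
      hs_trans C k l x = hs_trans A (\<rho> k) (\<rho> l) x"
proof -
  note H = assms(1)[unfolded haefliger_refines_via_def, rule_format, OF assms(2)]
  note H2 = H[THEN conjunct2] note H3 = H2[THEN conjunct2]
  show "\<rho> k \<in> hs_index A" by (rule H[THEN conjunct1])
  show "x \<in> hs_dom C k \<Longrightarrow> x \<in> hs_dom A (\<rho> k)" by (rule subsetD[OF H2[THEN conjunct1]])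
  show "x \<in> hs_dom C k \<Longrightarrow> hs_chart C k x = hs_chart A (\<rho> k) x"
    by (rule H3[THEN conjunct1, rule_format])
  show "l \<in> hs_index C \<Longrightarrow> x \<in> hs_dom C k \<Longrightarrow> x \<in> hs_dom C l \<Longrightarrow>
      hs_trans C k l x = hs_trans A (\<rho> k) (\<rho> l) x"
    by (rule H3[THEN conjunct2, rule_format]) auto
qed

lemma haefliger_refinesI:
  assumes "\<And>k. k \<in> hs_index C \<Longrightarrow> \<rho> k \<in> hs_index A"
    and "\<And>k x. k \<in> hs_index C \<Longrightarrow> x \<in> hs_dom C k \<Longrightarrow> x \<in> hs_dom A (\<rho> k)"
    and "\<And>k x. k \<in> hs_index C \<Longrightarrow> x \<in> hs_dom C k \<Longrightarrow> hs_chart C k x = hs_chart A (\<rho> k) x"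
    and "\<And>k l x. k \<in> hs_index C \<Longrightarrow> l \<in> hs_index C \<Longrightarrow> x \<in> hs_dom C k \<Longrightarrow> x \<in> hs_dom C l \<Longrightarrow>
      hs_trans C k l x = hs_trans A (\<rho> k) (\<rho> l) x"
  shows "haefliger_refines C A"
  unfolding haefliger_refines_def using assms by (intro exI[of _ \<rho>] ballI conjI subsetI) simp_all

lemma haefliger_refines_refl: "haefliger_refines A A"
  by (rule haefliger_refinesI[of _ "\<lambda>k. k"]) auto

lemma haefliger_refines_trans:
  assumes "haefliger_refines A B" "haefliger_refines B C"
  shows "haefliger_refines A C"
proof -
  obtain \<rho> where \<rho>: "haefliger_refines_via \<rho> A B" using assms(1) unfolding haefliger_refines_iff ..
  obtain \<sigma> where \<sigma>: "haefliger_refines_via \<sigma> B C" using assms(2) unfolding haefliger_refines_iff ..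
  show ?thesis
    by (rule haefliger_refinesI[of _ "\<lambda>k. \<sigma> (\<rho> k)"])
       (simp_all add: refines_via_index[OF \<rho>] refines_via_dom[OF \<rho>] refines_via_chart[OF \<rho>]
         refines_via_trans[OF \<rho>] refines_via_index[OF \<sigma>] refines_via_dom[OF \<sigma>]
         refines_via_chart[OF \<sigma>] refines_via_trans[OF \<sigma>])
qed

lemma haefliger_refines_pullback:
  assumes "haefliger_refines C A"
  shows "haefliger_refines (haefliger_pullback X h C) (haefliger_pullback X h A)"
proof -
  obtain \<rho> where \<rho>: "haefliger_refines_via \<rho> C A" using assms unfolding haefliger_refines_iff ..
  show ?thesis
    by (rule haefliger_refinesI[of _ \<rho>])
       (simp_all add: refines_via_index[OF \<rho>] refines_via_dom[OF \<rho>] refines_via_chart[OF \<rho>]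
         refines_via_trans[OF \<rho>])
qed

definition haefliger_reindex ::
  "'k set \<Rightarrow> ('k \<Rightarrow> 'i) \<Rightarrow> ('i, 'a, 'q::finite) haefliger \<Rightarrow> ('k, 'a, 'q) haefliger" where
  "haefliger_reindex J \<rho> F =
     \<lparr> hs_index = J, hs_dom = (\<lambda>k. hs_dom F (\<rho> k)), hs_chart = (\<lambda>k. hs_chart F (\<rho> k)),
       hs_trans = (\<lambda>k l. hs_trans F (\<rho> k) (\<rho> l)) \<rparr>"

lemma haefliger_reindex_sel [simp]:
  "hs_index (haefliger_reindex J \<rho> F) = J"
  "hs_dom (haefliger_reindex J \<rho> F) k = hs_dom F (\<rho> k)"
  "hs_chart (haefliger_reindex J \<rho> F) k = hs_chart F (\<rho> k)"
  "hs_trans (haefliger_reindex J \<rho> F) k l = hs_trans F (\<rho> k) (\<rho> l)"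
  by (simp_all add: haefliger_reindex_def)

lemma haefliger_refines_reindex:
  "\<rho> ` J \<subseteq> hs_index F \<Longrightarrow> haefliger_refines (haefliger_reindex J \<rho> F) F"
  by (rule haefliger_refinesI[of _ \<rho>]) auto

lemma haefliger_structure_reindex:
  assumes F: "haefliger_structure X F" and "\<rho> ` J \<subseteq> hs_index F" "(\<Union>k\<in>J. hs_dom F (\<rho> k)) = topspace X"
  shows "haefliger_structure X (haefliger_reindex J \<rho> F)"
proof -
  have \<rho>: "\<And>k. k \<in> J \<Longrightarrow> \<rho> k \<in> hs_index F" using assms(2) by blast
  show ?thesis
    unfolding haefliger_structure_def haefliger_reindex_sel
    by (intro conjI ballI hs_dom_open[OF F] hs_chart_continuous[OF F] hs_trans_continuous[OF F]
        hs_trans_carries[OF F] hs_cocycle[OF F] \<rho> assms(3)) simp_all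
qed

text \<open>Each \<open>k\<close> receives a chart around the point \<open>\<pi> k\<close>, and
  these charts cover because \<open>\<pi>\<close> is onto. The free index type lets the lemma supply
  structures indexed by points and by tagged points.\<close>

lemma refinement_indexed_by_points:
  fixes F :: "('i, 'a, 'q::finite) haefliger" and \<pi> :: "'k \<Rightarrow> 'a"
  assumes F: "haefliger_structure X F" and "\<pi> ` J = topspace X"
  obtains C :: "('k, 'a, 'q) haefliger" where "haefliger_structure X C" "haefliger_refines C F"
proof -
  define \<rho> where "\<rho> k = (SOME \<alpha>. \<alpha> \<in> hs_index F \<and> \<pi> k \<in> hs_dom F \<alpha>)" for k
  have \<rho>: "\<rho> k \<in> hs_index F \<and> \<pi> k \<in> hs_dom F (\<rho> k)" if "k \<in> J" for k
  proof -
    have "\<pi> k \<in> (\<Union>\<alpha>\<in>hs_index F. hs_dom F \<alpha>)"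
      unfolding hs_cover[OF F] assms(2)[symmetric] using that by (rule imageI)
    then have "\<exists>\<alpha>. \<alpha> \<in> hs_index F \<and> \<pi> k \<in> hs_dom F \<alpha>" by auto
    from someI_ex[OF this] show ?thesis unfolding \<rho>_def .
  qed
  have "(\<Union>k\<in>J. hs_dom F (\<rho> k)) = topspace X"
  proof (intro equalityI subsetI)
    fix x assume "x \<in> (\<Union>k\<in>J. hs_dom F (\<rho> k))"
    then obtain k where k: "k \<in> J" "x \<in> hs_dom F (\<rho> k)" by auto
    then show "x \<in> topspace X"
      using openin_subset[OF hs_dom_open[OF F]] \<rho>[OF k(1)] by auto
  next
    fix x assume "x \<in> topspace X"
    then obtain k where "k \<in> J" "x = \<pi> k" unfolding assms(2)[symmetric] by (rule imageE)
    then show "x \<in> (\<Union>k\<in>J. hs_dom F (\<rho> k))" using \<rho>[of k] by auto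
  qed
  moreover have "\<rho> ` J \<subseteq> hs_index F" using \<rho> by auto
  ultimately show thesis
    by (intro that[of "haefliger_reindex J \<rho> F"] haefliger_structure_reindex[OF F] haefliger_refines_reindex)
qed

text \<open>The chain in the middle of the equivalence may have length zero: \<open>A'\<close> and
  \<open>B'\<close> are both taken to be one refinement of \<open>C\<close> indexed by tagged
  points.\<close>

lemma haefliger_equivalentI:
  fixes A :: "('i, 'a, 'q::finite) haefliger" and B :: "('j, 'a, 'q) haefliger"
  assumes "haefliger_structure X A" "haefliger_structure X B" "haefliger_structure X C"
    and "haefliger_refines C A" "haefliger_refines C B"
  shows "haefliger_equivalent X A B"
proof -
  have "fst ` (topspace X \<times> {True}) = topspace X" by force
  from refinement_indexed_by_points[OF assms(3) this]
  obtain D :: "('a \<times> bool, 'a, 'q) haefliger" where D: "haefliger_structure X D" "haefliger_refines D C" .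
  then have "haefliger_refines D A" "haefliger_refines D B"
    using assms(4,5) haefliger_refines_trans by blast+
  then have "common_refinement X A D" "common_refinement X D B"
    using D assms(1,2) haefliger_refines_refl[of D] unfolding common_refinement_def by blast+
  then show ?thesis unfolding haefliger_equivalent_def by blast
qed

section \<open>Transverse orientations under pullback and refinement\<close>

lemma transverse_orientation_pullback:
  assumes "transverse_orientation Y F \<omega>" "continuous_map X Y h"
  shows "transverse_orientation X (haefliger_pullback X h F) (\<lambda>\<alpha> x. \<omega> \<alpha> (h x))"
proof -
  have sub: "continuous_map (subtopology X {x \<in> topspace X. h x \<in> S}) (subtopology Y S) h" for S
    using assms(2) by (auto simp: continuous_map_in_subtopology continuous_map_from_subtopology)
  have cont: "continuous_map (subtopology X {x \<in> topspace X. h x \<in> hs_dom F \<alpha>}) (discrete_topology {-1, 1})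
      (\<lambda>x. \<omega> \<alpha> (h x))" if "\<alpha> \<in> hs_index F" for \<alpha>
    using continuous_map_compose[OF sub assms(1)[unfolded transverse_orientation_def bundle_orientation_def,
        THEN conjunct1, rule_format, OF that]]
    by (simp add: o_def)
  have sgn: "\<omega> \<beta> (h x) = sgn (det (normal_cocycle (haefliger_pullback X h F) \<beta> \<alpha> x)) * \<omega> \<alpha> (h x)"
    if "\<alpha> \<in> hs_index F" "\<beta> \<in> hs_index F" "h x \<in> hs_dom F \<alpha> \<inter> hs_dom F \<beta>" for \<alpha> \<beta> x
    unfolding normal_cocycle_def haefliger_pullback_sel
    by (rule assms(1)[unfolded transverse_orientation_def bundle_orientation_def normal_cocycle_def,
        THEN conjunct2, rule_format, OF that])
  show ?thesis
    unfolding transverse_orientation_def bundle_orientation_def haefliger_pullback_sel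
    by (intro conjI ballI cont sgn) simp_all
qed

lemma transversely_orientable_refines:
  assumes "transverse_orientation X F \<omega>" "haefliger_refines C F"
  shows "transversely_orientable X C"
proof -
  obtain \<rho> where \<rho>: "haefliger_refines_via \<rho> C F" using assms(2) unfolding haefliger_refines_iff ..
  note \<omega> = assms(1)[unfolded transverse_orientation_def bundle_orientation_def normal_cocycle_def]
  have "continuous_map (subtopology X (hs_dom C k)) (discrete_topology {-1, 1}) (\<omega> (\<rho> k))"
    if k: "k \<in> hs_index C" for k
  proof (rule continuous_map_from_subtopology_mono)
    show "continuous_map (subtopology X (hs_dom F (\<rho> k))) (discrete_topology {-1, 1}) (\<omega> (\<rho> k))"
      by (rule \<omega>[THEN conjunct1, rule_format, OF refines_via_index[OF \<rho> k]])
    show "hs_dom C k \<subseteq> hs_dom F (\<rho> k)" using refines_via_dom[OF \<rho> k] by blast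
  qed
  moreover have "\<omega> (\<rho> l) x = sgn (det (normal_cocycle C l k x)) * \<omega> (\<rho> k) x"
    if kl: "k \<in> hs_index C" "l \<in> hs_index C" and x: "x \<in> hs_dom C k \<inter> hs_dom C l" for k l x
  proof -
    have "x \<in> hs_dom F (\<rho> k) \<inter> hs_dom F (\<rho> l)" using refines_via_dom[OF \<rho>] kl x by blast
    then have "\<omega> (\<rho> l) x = sgn (det (germ_differential (hs_trans F (\<rho> l) (\<rho> k) x))) * \<omega> (\<rho> k) x"
      using \<omega>[THEN conjunct2, rule_format, OF refines_via_index[OF \<rho> kl(1)] refines_via_index[OF \<rho> kl(2)]] by simp
    then show ?thesis
      using refines_via_trans[OF \<rho> kl(2,1), of x] x by (simp add: normal_cocycle_def)
  qed
  ultimately show ?thesis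
    unfolding transversely_orientable_def transverse_orientation_def bundle_orientation_def
    by (intro exI[of _ "\<lambda>k. \<omega> (\<rho> k)"] conjI ballI)
qed

text \<open>For a locally constant map all preimages are open, whatever the topology of the target.
  This will handle the transition functions into \<open>Gamma\<close> that involve the new
  chart.\<close>

lemma continuous_map_locally_constant:
  assumes "\<And>w. w \<in> topspace X \<Longrightarrow> f w \<in> topspace Y"
    and "\<And>w. w \<in> topspace X \<Longrightarrow> \<exists>N. openin X N \<and> w \<in> N \<and> (\<forall>v\<in>N. f v = f w)"
  shows "continuous_map X Y f"
  unfolding continuous_map
proof (intro conjI allI impI)
  fix U assume "openin Y U"
  show "openin X {x \<in> topspace X. f x \<in> U}"
  proof (subst openin_subopen, safe)
    fix w assume "w \<in> topspace X" "f w \<in> U"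
    with assms(2)[of w] show "\<exists>T. openin X T \<and> w \<in> T \<and> T \<subseteq> {x \<in> topspace X. f x \<in> U}"
      by (metis (mono_tags, lifting) mem_Collect_eq openin_subset subset_iff)
  qed
qed (use assms(1) in blast)

section \<open>Gluing in a constant chart\<close>

text \<open>
  The map \<open>r\<close> on the open set \<open>V\<close> pulls \<open>F\<close> back to \<open>V\<close>.  The set \<open>E\<close>, on whose two sides \<open>r\<close> is
  constant, receives one new chart, with index \<open>None\<close>.  It is written as \<open>A\<close> applied to the chart
  \<open>\<alpha> b\<close> minus its value at \<open>p b\<close>, hence is \<open>0\<close>; so \<open>side\<close>, and the value of \<open>r\<close>, may jump at \<open>E - V\<close>.
\<close>

locale clutching =
  fixes X :: "'w topology" and M :: "'a topology" and F :: "('i, 'a, 'q::finite) haefliger"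
    and E V :: "'w set" and r :: "'w \<Rightarrow> 'a" and side :: "'w \<Rightarrow> bool" and p :: "bool \<Rightarrow> 'a"
    and \<alpha> :: "bool \<Rightarrow> 'i" and A :: "bool \<Rightarrow> real^'q \<Rightarrow> real^'q"
  assumes F: "haefliger_structure M F"
    and E_open: "openin X E" and V_open: "openin X V" and E_V: "E \<union> V = topspace X"
    and r_continuous: "continuous_map (subtopology X V) M r"
    and r_E: "\<And>w. w \<in> E \<Longrightarrow> r w = p (side w)"
    and side_open: "\<And>b. openin X {w \<in> E \<inter> V. side w = b}"
    and \<alpha>: "\<And>b. \<alpha> b \<in> hs_index F" and p: "\<And>b. p b \<in> hs_dom F (\<alpha> b)"
    and A: "\<And>b. involution (A b)"
begin

text \<open>With \<open>idx\<close>, \<open>lin\<close> and \<open>org\<close> the new chart and the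
  charts of \<open>F\<close> obey one formula: the chart \<open>idx\<close> of \<open>F\<close>
  along \<open>r\<close>, minus \<open>org\<close>, under \<open>lin\<close>. For
  \<open>Some a\<close> the coordinate change is trivial, for \<open>None\<close> it depends on the
  side.\<close>

definition idx :: "'i option \<Rightarrow> 'w \<Rightarrow> 'i" where
  "idx i w = (case i of None \<Rightarrow> \<alpha> (side w) | Some a \<Rightarrow> a)"

definition lin :: "'i option \<Rightarrow> 'w \<Rightarrow> real^'q \<Rightarrow> real^'q" where
  "lin i w = (case i of None \<Rightarrow> A (side w) | Some a \<Rightarrow> \<lambda>x. x)"

definition org :: "'i option \<Rightarrow> 'w \<Rightarrow> real^'q" where
  "org i w = (case i of None \<Rightarrow> hs_chart F (\<alpha> (side w)) (p (side w)) | Some a \<Rightarrow> 0)"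

definition clutch :: "('i option, 'w, 'q) haefliger" where
  "clutch =
    \<lparr> hs_index = insert None (Some ` hs_index F),
      hs_dom = (\<lambda>i. case i of None \<Rightarrow> E | Some a \<Rightarrow> {w \<in> V. r w \<in> hs_dom F a}),
      hs_chart = (\<lambda>i w. lin i w (hs_chart F (idx i w) (r w) - org i w)),
      hs_trans = (\<lambda>j i w. germ_conj (lin j w) (org j w) (lin i w) (org i w)
        (hs_trans F (idx j w) (idx i w) (r w))) \<rparr>"

lemma clutch_sel [simp]:
  "hs_index clutch = insert None (Some ` hs_index F)"
  "hs_dom clutch None = E"
  "hs_dom clutch (Some a) = {w \<in> V. r w \<in> hs_dom F a}"
  "hs_chart clutch i = (\<lambda>w. lin i w (hs_chart F (idx i w) (r w) - org i w))"
  "hs_trans clutch j i w = germ_conj (lin j w) (org j w) (lin i w) (org i w)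
        (hs_trans F (idx j w) (idx i w) (r w))"
  by (simp_all add: clutch_def)

lemma involution_lin: "involution (lin i w)"
  by (cases i) (simp_all add: lin_def A involution_id)

lemma idx_in:
  assumes "i \<in> hs_index clutch" "w \<in> hs_dom clutch i"
  shows "idx i w \<in> hs_index F" "r w \<in> hs_dom F (idx i w)"
  using assms \<alpha> p r_E by (auto simp: idx_def)

text \<open>On \<open>E\<close> the map \<open>r\<close> stays at \<open>p (side w)\<close>, whose
  chart value is exactly the origin subtracted. The chart is thus continuous even where
  \<open>side\<close> jumps.\<close>

lemma clutch_chart_None:
  "w \<in> E \<Longrightarrow> hs_chart clutch None w = 0"
  using linear_0[OF involution_linear[OF A]] by (simp add: lin_def org_def idx_def r_E)

text \<open>The germ of \<open>F\<close> is an identity by \<open>hs_trans_self\<close>, and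
  conjugating it by an involution leaves the identity germ at the origin, the same on both sides of
  \<open>E\<close>.\<close>

lemma clutch_trans_None:
  "w \<in> E \<Longrightarrow> hs_trans clutch None None w = germ (\<lambda>x. x) 0"
  using linear_0[OF involution_linear[OF A]]
  by (simp add: lin_def org_def idx_def r_E hs_trans_self[OF F \<alpha> p] germ_conj_germ[OF A]
      involution_involution[OF A])

lemma clutch_trans_Some:
  assumes "a \<in> hs_index F" "b \<in> hs_index F" "r w \<in> hs_dom F a" "r w \<in> hs_dom F b"
  shows "hs_trans clutch (Some b) (Some a) w = hs_trans F b a (r w)"
  using germ_conj_id[OF hs_trans_in_Gamma[OF F assms]] by (simp add: lin_def org_def idx_def)

lemma clutch_trans_in_Gamma:
  assumes "i \<in> hs_index clutch" "j \<in> hs_index clutch" "w \<in> hs_dom clutch i" "w \<in> hs_dom clutch j"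
  shows "hs_trans clutch j i w \<in> topspace Gamma"
  unfolding clutch_sel
  by (intro germ_conj_in_Gamma involution_lin hs_trans_in_Gamma[OF F] idx_in assms)

lemma r_preimage_open:
  assumes "openin M U"
  shows "openin X {w \<in> V. r w \<in> U}"
proof -
  have "topspace (subtopology X V) = V"
    using V_open by (simp add: inf.absorb2 openin_subset)
  then have "openin (subtopology X V) {w \<in> V. r w \<in> U}"
    using openin_continuous_map_preimage[OF r_continuous assms] by simp
  then show ?thesis
    using V_open by (simp add: openin_open_subtopology)
qed

lemma clutch_dom_open: "i \<in> hs_index clutch \<Longrightarrow> openin X (hs_dom clutch i)"
  using r_preimage_open[OF hs_dom_open[OF F]] E_open by auto

text \<open>From the new chart to itself, chart and germ are constant on all of \<open>E\<close>. If
  only one index is \<open>None\<close>, then \<open>w\<close> lies in \<open>V\<close> too, and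
  near \<open>w\<close> everything depends on \<open>side\<close> alone, which is locally constant
  on \<open>E \<inter> V\<close>.\<close>

lemma clutch_locally_constant:
  assumes "i = None \<or> j = None" and wi: "w \<in> hs_dom clutch i" and wj: "w \<in> hs_dom clutch j"
  shows "\<exists>N. openin X N \<and> w \<in> N \<and> N \<subseteq> hs_dom clutch i \<inter> hs_dom clutch j \<and>
    (\<forall>v\<in>N. hs_chart clutch i v = hs_chart clutch i w \<and> hs_chart clutch j v = hs_chart clutch j w \<and>
       hs_trans clutch j i v = hs_trans clutch j i w)"
proof (cases "i = None \<and> j = None")
  case True
  then have E: "w \<in> E" "E \<subseteq> hs_dom clutch i \<inter> hs_dom clutch j" using assms by auto
  have ij: "i = None" "j = None" using True by auto
  show ?thesis
    by (intro exI[of _ E] conjI ballI E_open E)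
       (simp_all add: ij E(1) clutch_chart_None clutch_trans_None del: clutch_sel)
next
  case False
  let ?N = "{v \<in> E \<inter> V. side v = side w}"
  have w: "w \<in> E" using assms by auto
  have "w \<in> V" using assms False by (cases i; cases j) auto
  note w = w this
  then have "w \<in> ?N" by simp
  have eq: "r v = r w" "idx k v = idx k w" "lin k v = lin k w" "org k v = org k w" if "v \<in> ?N" for k v
  proof -
    have "side v = side w" "v \<in> E" using that by auto
    then show "r v = r w" "idx k v = idx k w" "lin k v = lin k w" "org k v = org k w"
      by (simp_all only: r_E[OF \<open>v \<in> E\<close>] r_E[OF w(1)] idx_def lin_def org_def \<open>side v = side w\<close>)
  qed
  have "?N \<subseteq> hs_dom clutch k" if "w \<in> hs_dom clutch k" for k
    using that w by (cases k) (auto simp: r_E)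
  then have "?N \<subseteq> hs_dom clutch i \<inter> hs_dom clutch j" using assms by simp
  then show ?thesis
  proof (intro exI[of _ ?N] conjI ballI side_open \<open>w \<in> ?N\<close>)
    fix v assume v: "v \<in> ?N"
    show "hs_chart clutch i v = hs_chart clutch i w" "hs_chart clutch j v = hs_chart clutch j w"
      "hs_trans clutch j i v = hs_trans clutch j i w"
      unfolding clutch_sel eq[OF v] by (rule refl)+
  qed
qed

lemma continuous_map_clutch_chart:
  assumes "i \<in> hs_index clutch"
  shows "continuous_map (subtopology X (hs_dom clutch i)) euclidean (hs_chart clutch i)"
proof (cases i)
  case None
  have "continuous_map (subtopology X E) euclidean (\<lambda>w. 0 :: real^'q)" by simp
  then have "continuous_map (subtopology X E) euclidean (hs_chart clutch None)"
    by (rule continuous_map_eq) (use clutch_chart_None in auto)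
  then show ?thesis using None by simp
next
  case (Some a)
  have sub: "continuous_map (subtopology X (hs_dom clutch i)) (subtopology M (hs_dom F a)) r"
    using Some by (auto simp: continuous_map_in_subtopology
        intro: continuous_map_from_subtopology_mono[OF r_continuous])
  have "a \<in> hs_index F" using assms Some by auto
  from continuous_map_compose[OF sub hs_chart_continuous[OF F this]] show ?thesis
    using Some by (simp add: lin_def org_def idx_def o_def)
qed

lemma continuous_map_clutch_trans:
  assumes ij: "i \<in> hs_index clutch" "j \<in> hs_index clutch"
  shows "continuous_map (subtopology X (hs_dom clutch i \<inter> hs_dom clutch j)) Gamma (hs_trans clutch j i)"
proof (cases "i = None \<or> j = None")
  case True
  let ?D = "hs_dom clutch i \<inter> hs_dom clutch j"
  show ?thesis
  proof (rule continuous_map_locally_constant)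
    fix w assume "w \<in> topspace (subtopology X ?D)"
    then have w: "w \<in> hs_dom clutch i" "w \<in> hs_dom clutch j" by simp_all
    show "hs_trans clutch j i w \<in> topspace Gamma"
      by (rule clutch_trans_in_Gamma[OF ij w])
    obtain N where N: "openin X N" "w \<in> N" "N \<subseteq> ?D"
      "\<forall>v\<in>N. hs_trans clutch j i v = hs_trans clutch j i w"
      using clutch_locally_constant[OF True w] by blast
    moreover have "openin (subtopology X ?D) N"
      using N(1,3) unfolding openin_subtopology by blast
    ultimately show "\<exists>N. openin (subtopology X ?D) N \<and> w \<in> N \<and>
        (\<forall>v\<in>N. hs_trans clutch j i v = hs_trans clutch j i w)"
      by blast
  qed
next
  case False
  then obtain a b where ab: "i = Some a" "j = Some b" by auto
  have in_F: "a \<in> hs_index F" "b \<in> hs_index F" using ij ab by auto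
  have sub: "continuous_map (subtopology X (hs_dom clutch i \<inter> hs_dom clutch j))
      (subtopology M (hs_dom F a \<inter> hs_dom F b)) r"
    using ab by (auto simp: continuous_map_in_subtopology
        intro: continuous_map_from_subtopology_mono[OF r_continuous])
  from continuous_map_compose[OF sub hs_trans_continuous[OF F in_F]]
  show ?thesis
    by (rule continuous_map_eq) (use ab in_F clutch_trans_Some in \<open>auto simp del: clutch_sel(5)\<close>)
qed

text \<open>If the new chart is involved, both charts are constant near \<open>w\<close>, so it
  suffices that the germ has the right value there. Otherwise the relation is pulled back from
  \<open>F\<close> along \<open>r\<close>.\<close>

lemma germ_carries_clutch:
  assumes ij: "i \<in> hs_index clutch" "j \<in> hs_index clutch" and w: "w \<in> hs_dom clutch i" "w \<in> hs_dom clutch j"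
  shows "germ_carries X (hs_trans clutch j i w) (hs_chart clutch i) (hs_chart clutch j) w"
proof -
  note in_F = idx_in[OF ij(1) w(1)] idx_in[OF ij(2) w(2)]
  obtain g where g: "g \<in> snd (hs_trans F (idx j w) (idx i w) (r w))"
    "fst (hs_trans F (idx j w) (idx i w) (r w)) = hs_chart F (idx i w) (r w)"
    and gv: "hs_chart F (idx j w) (r w) = g (hs_chart F (idx i w) (r w))"
    and gN: "\<exists>N. openin M N \<and> r w \<in> N \<and> (\<forall>y\<in>N. hs_chart F (idx j w) y = g (hs_chart F (idx i w) y))"
    using hs_trans_carries[OF F in_F(1,3,2,4)] unfolding germ_carries_def by blast
  \<comment> \<open>So far \<open>g\<close> is only a member of the class of the transition germ.
    Comparison with a representative \<open>k\<close> shows that this germ is the germ of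
    \<open>g\<close>, the form that \<open>germ_conj_germ\<close> takes.\<close>
  obtain k y where k: "hs_trans F (idx j w) (idx i w) (r w) = germ k y"
    using hs_trans_in_Gamma[OF F in_F(1,3,2,4)] by (auto simp: topspace_Gamma_iff)
  have "y = hs_chart F (idx i w) (r w)" "\<forall>\<^sub>F z in nhds y. g z = k z"
    using g unfolding k germ_mem_iff fst_germ by simp_all
  then have "hs_trans F (idx j w) (idx i w) (r w) = germ g (hs_chart F (idx i w) (r w))"
    unfolding k using germ_cong by metis
  then have trans: "hs_trans clutch j i w =
      germ (\<lambda>y. lin j w (g (lin i w y + org i w) - org j w)) (hs_chart clutch i w)"
    by (simp add: germ_conj_germ[OF involution_lin])
  let ?g = "\<lambda>y. lin j w (g (lin i w y + org i w) - org j w)"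
  have "\<exists>N. openin X N \<and> w \<in> N \<and> (\<forall>v\<in>N. hs_chart clutch j v = ?g (hs_chart clutch i v))"
  proof (cases "i = None \<or> j = None")
    case True
    obtain N where N: "openin X N" "w \<in> N"
      "\<forall>v\<in>N. hs_chart clutch i v = hs_chart clutch i w"
      "\<forall>v\<in>N. hs_chart clutch j v = hs_chart clutch j w"
      using clutch_locally_constant[OF True w] by blast
    have gw: "hs_chart clutch j w = ?g (hs_chart clutch i w)"
      by (simp add: involution_involution[OF involution_lin] gv)
    have "hs_chart clutch j v = ?g (hs_chart clutch i v)" if "v \<in> N" for v
      unfolding N(3)[rule_format, OF that] N(4)[rule_format, OF that] by (rule gw)
    with N(1,2) show ?thesis by blast
  next
    case False
    then obtain a b where ab: "i = Some a" "j = Some b" by auto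
    obtain N where N: "openin M N" "r w \<in> N" "\<forall>y\<in>N. hs_chart F (idx j w) y = g (hs_chart F (idx i w) y)"
      using gN by blast
    have "openin X {v \<in> V. r v \<in> N}" by (rule r_preimage_open[OF N(1)])
    moreover have "w \<in> V" using ab w by simp
    ultimately show ?thesis
      using N ab by (intro exI[of _ "{v \<in> V. r v \<in> N}"]) (auto simp: lin_def org_def idx_def)
  qed
  then show ?thesis
    unfolding germ_carries_def trans fst_germ by (intro conjI refl bexI[OF _ germ_mem])
qed

text \<open>This is the cocycle condition of \<open>F\<close> at \<open>r w\<close>, conjugated: all
  germs are read at the single point \<open>w\<close>, so the coordinate changes of the middle index
  cancel.\<close>

lemma clutch_cocycle:
  assumes ijk: "i \<in> hs_index clutch" "j \<in> hs_index clutch" "k \<in> hs_index clutch"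
    and w: "w \<in> hs_dom clutch i" "w \<in> hs_dom clutch j" "w \<in> hs_dom clutch k"
  shows "hs_trans clutch k i w = germ_comp (hs_trans clutch k j w) (hs_trans clutch j i w)"
proof -
  note in_F = idx_in[OF ijk(1) w(1)] idx_in[OF ijk(2) w(2)] idx_in[OF ijk(3) w(3)]
  obtain g where g: "g \<in> snd (hs_trans F (idx j w) (idx i w) (r w))"
    "fst (hs_trans F (idx j w) (idx i w) (r w)) = hs_chart F (idx i w) (r w)"
    "hs_chart F (idx j w) (r w) = g (hs_chart F (idx i w) (r w))"
    using hs_trans_value[OF F in_F(1,3,2,4)] .
  have "fst (hs_trans F (idx k w) (idx j w) (r w)) = g (fst (hs_trans F (idx j w) (idx i w) (r w)))"
    using hs_trans_value[OF F in_F(3,5,4,6)] g by metis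
  then show ?thesis
    unfolding clutch_sel
    by (subst germ_conj_comp[OF involution_lin involution_lin involution_lin _ _ g(1)])
       (simp_all add: hs_trans_in_Gamma[OF F] in_F hs_cocycle[OF F, symmetric])
qed

lemma haefliger_structure_clutch: "haefliger_structure X clutch"
proof -
  have "(\<Union>i\<in>hs_index clutch. hs_dom clutch i) = E \<union> {w \<in> V. r w \<in> (\<Union>a\<in>hs_index F. hs_dom F a)}"
    by auto
  also have "\<dots> = topspace X"
    using E_V continuous_map_funspace[OF r_continuous] unfolding hs_cover[OF F] by auto
  finally have cover: "(\<Union>i\<in>hs_index clutch. hs_dom clutch i) = topspace X" .
  show ?thesis
    unfolding haefliger_structure_def
    by (intro conjI ballI clutch_dom_open cover continuous_map_clutch_chart continuous_map_clutch_trans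
        germ_carries_clutch clutch_cocycle) (simp_all only: Int_iff)
qed

section \<open>Restriction and orientation of the clutched structure\<close>

lemma clutch_pullback_refines:
  assumes "\<And>y. y \<in> topspace Y \<Longrightarrow> h y \<notin> E \<and> r (h y) = k y"
  shows "haefliger_refines (haefliger_pullback Y h clutch) (haefliger_pullback Y k F)"
\<comment> \<open>Since \<open>h\<close> avoids \<open>E\<close>, the pulled-back new chart has
  empty domain; \<open>\<alpha> True\<close> is a default index to send it to.\<close>
proof (rule haefliger_refinesI[of _ "\<lambda>i. case i of None \<Rightarrow> \<alpha> True | Some a \<Rightarrow> a"])
  fix i assume "i \<in> hs_index (haefliger_pullback Y h clutch)"
  then show "(case i of None \<Rightarrow> \<alpha> True | Some a \<Rightarrow> a) \<in> hs_index (haefliger_pullback Y k F)"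
    using \<alpha> by auto
  fix x assume x: "x \<in> hs_dom (haefliger_pullback Y h clutch) i"
  then obtain a where "i = Some a" using assms by (cases i) auto
  then show "x \<in> hs_dom (haefliger_pullback Y k F) (case i of None \<Rightarrow> \<alpha> True | Some a \<Rightarrow> a)"
    and "hs_chart (haefliger_pullback Y h clutch) i x =
      hs_chart (haefliger_pullback Y k F) (case i of None \<Rightarrow> \<alpha> True | Some a \<Rightarrow> a) x"
    using x assms by (auto simp: lin_def org_def idx_def)
next
  fix i j x
  assume ij: "i \<in> hs_index (haefliger_pullback Y h clutch)" "j \<in> hs_index (haefliger_pullback Y h clutch)"
    and x: "x \<in> hs_dom (haefliger_pullback Y h clutch) i" "x \<in> hs_dom (haefliger_pullback Y h clutch) j"
  obtain a b where ab: "i = Some a" "j = Some b" using assms x by (cases i; cases j) auto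
  then have "hs_trans clutch i j (h x) = hs_trans F a b (r (h x))"
    using ij x unfolding ab by (intro clutch_trans_Some) auto
  then show "hs_trans (haefliger_pullback Y h clutch) i j x =
      hs_trans (haefliger_pullback Y k F) (case i of None \<Rightarrow> \<alpha> True | Some a \<Rightarrow> a)
        (case j of None \<Rightarrow> \<alpha> True | Some a \<Rightarrow> a) x"
    using ab x assms by simp
qed

text \<open>The hypothesis \<open>norm\<close> makes the sign of the new chart \<open>1\<close> on
  both sides of \<open>E\<close>, hence constant although \<open>side\<close> jumps. In the other
  charts the signs are those of \<open>F\<close> along \<open>r\<close>.\<close>

lemma clutch_orientation:
  assumes \<omega>: "transverse_orientation M F \<omega>" and det: "\<And>b. det (matrix (A b)) \<in> {-1, 1}"
    and norm: "\<And>b. det (matrix (A b)) * \<omega> (\<alpha> b) (p b) = 1"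
  shows "transverse_orientation X clutch (\<lambda>i w. det (matrix (lin i w)) * \<omega> (idx i w) (r w))"
proof -
  let ?\<omega> = "\<lambda>i w. det (matrix (lin i w)) * \<omega> (idx i w) (r w)"
  have id: "det (matrix (\<lambda>x :: real^'q. x)) = 1"
    by (simp add: matrix_id_mat_1 flip: id_def)
  have cont: "continuous_map (subtopology X (hs_dom clutch i)) (discrete_topology {-1, 1}) (?\<omega> i)"
    if "i \<in> hs_index clutch" for i
  proof (cases i)
    case None
    have "continuous_map (subtopology X E) (discrete_topology {-1, 1 :: real}) (\<lambda>w. 1)" by simp
    then have "continuous_map (subtopology X E) (discrete_topology {-1, 1}) (?\<omega> None)"
      by (rule continuous_map_eq) (auto simp: lin_def idx_def r_E norm)
    then show ?thesis using None by simp
  next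
    case (Some a)
    have sub: "continuous_map (subtopology X (hs_dom clutch i)) (subtopology M (hs_dom F a)) r"
      using Some by (auto simp: continuous_map_in_subtopology
          intro: continuous_map_from_subtopology_mono[OF r_continuous])
    have "continuous_map (subtopology M (hs_dom F a)) (discrete_topology {-1, 1}) (\<omega> a)"
      by (rule \<omega>[unfolded transverse_orientation_def bundle_orientation_def, THEN conjunct1, rule_format])
        (use that Some in auto)
    from continuous_map_compose[OF sub this] show ?thesis
      using Some by (simp add: lin_def idx_def id o_def)
  qed
  have det_lin: "det (matrix (lin i w)) \<in> {-1, 1}" for i w
    using det by (cases i) (auto simp: lin_def id)
  have "?\<omega> j w = sgn (det (normal_cocycle clutch j i w)) * ?\<omega> i w"
    if ij: "i \<in> hs_index clutch" "j \<in> hs_index clutch" and w: "w \<in> hs_dom clutch i" "w \<in> hs_dom clutch j" for i j w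
  proof -
    note in_F = idx_in[OF ij(1) w(1)] idx_in[OF ij(2) w(2)]
    have "\<omega> (idx j w) (r w) = sgn (det (normal_cocycle F (idx j w) (idx i w) (r w))) * \<omega> (idx i w) (r w)"
      by (rule \<omega>[unfolded transverse_orientation_def bundle_orientation_def, THEN conjunct2, rule_format])
        (use in_F in auto)
    moreover have "det (normal_cocycle clutch j i w) = det (matrix (lin j w)) *
        det (normal_cocycle F (idx j w) (idx i w) (r w)) * det (matrix (lin i w))"
      unfolding normal_cocycle_def clutch_sel
      by (intro det_germ_differential_conj involution_lin hs_trans_in_Gamma[OF F] in_F)
    \<comment> \<open>Each \<open>det (matrix (lin i w))\<close> is a sign, so it equals its own
      \<open>sgn\<close> and has square \<open>1\<close>.\<close>
    ultimately show ?thesis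
      using det_lin[of i w] det_lin[of j w] by (elim insertE emptyE) (simp_all add: sgn_mult)
  qed
  note sgn = this
  show ?thesis
    unfolding transverse_orientation_def bundle_orientation_def by (intro conjI ballI cont sgn) simp_all
qed

end

section \<open>The retraction of the trace\<close>

lemma
  assumes "h ` A \<subseteq> topspace X"
  shows continuous_map_attach_Inl: "continuous_map X (attach X Y A h) Inl"
    and continuous_map_attach_map: "continuous_map Y (attach X Y A h) (attach_map A h)"
  using assms by (auto simp: continuous_map openin_attach topspace_attach attach_map_def)

text \<open>The universal property of the quotient topology: continuity is tested on
  \<open>X\<close> and, along the quotient map, on \<open>Y\<close>.\<close>

lemma continuous_map_from_attach:
  assumes h: "h ` A \<subseteq> topspace X"
    and X: "continuous_map X Z (\<lambda>x. f (Inl x))" and Y: "continuous_map Y Z (\<lambda>y. f (attach_map A h y))"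
  shows "continuous_map (attach X Y A h) Z f"
  unfolding continuous_map
proof (intro conjI allI impI)
  show "f ` topspace (attach X Y A h) \<subseteq> topspace Z"
    using continuous_map_funspace[OF X] continuous_map_funspace[OF Y]
    by (force simp: topspace_attach[OF h] attach_map_def Pi_iff)
next
  fix U assume U: "openin Z U"
  let ?P = "{w \<in> topspace (attach X Y A h). f w \<in> U}"
  have "{x \<in> topspace X. Inl x \<in> ?P} = {x \<in> topspace X. f (Inl x) \<in> U}"
    and "{y \<in> topspace Y. attach_map A h y \<in> ?P} = {y \<in> topspace Y. f (attach_map A h y) \<in> U}"
    using h by (auto simp: topspace_attach[OF h] attach_map_def)
  then show "openin (attach X Y A h) ?P"
    unfolding openin_attach
    using openin_continuous_map_preimage[OF X U] openin_continuous_map_preimage[OF Y U]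
    by (auto simp: topspace_attach[OF h])
qed

text \<open>Read in a chart of \<open>M\<close>, the embedding of an open disc is a continuous
  injection between Euclidean spaces of equal dimension, so invariance of domain applies.\<close>

lemma openin_disc_image:
  fixes \<A> :: "('a set \<times> ('a \<Rightarrow> real^'n)) set" and \<phi> :: "real \<times> (real^'n) \<Rightarrow> 'a"
  assumes "smooth_manifold M \<A>" "embedding_map (top_of_set (sphere 0 1 \<times> cball 0 3)) M \<phi>"
  shows "openin M (\<phi> ` (sphere 0 1 \<times> ball 0 2))"
proof (subst openin_subopen, safe)
  fix e :: real and y :: "real^'n"
  assume e: "e \<in> sphere 0 1" and y: "y \<in> ball 0 2"
  let ?D = "sphere 0 1 \<times> cball 0 3 :: (real \<times> (real^'n)) set"
  have cont: "continuous_map (top_of_set ?D) M \<phi>" and inj: "inj_on \<phi> ?D"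
    using assms(2) by (auto simp: embedding_map_def homeomorphic_eq_everything_map continuous_map_in_subtopology)
  have "\<phi> (e, y) \<in> topspace M"
    using continuous_map_funspace[OF cont] e y by (auto simp: Pi_iff)
  then obtain U \<kappa> where U: "(U, \<kappa>) \<in> \<A>" "\<phi> (e, y) \<in> U" "openin M U"
    and \<kappa>: "homeomorphic_map (subtopology M U) (top_of_set (\<kappa> ` U)) \<kappa>"
    using assms(1) unfolding smooth_manifold_def by fast
  have "U \<subseteq> topspace M" using U(3) by (rule openin_subset)
  then have \<kappa>_cont: "continuous_map (subtopology M U) euclidean \<kappa>" and \<kappa>_inj: "inj_on \<kappa> U"
    using \<kappa> by (auto simp: homeomorphic_eq_everything_map continuous_map_in_subtopology Int_absorb1)
  define O' where "O' = {z \<in> ball 0 2. \<phi> (e, z) \<in> U}"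
  have "continuous_map (top_of_set (ball 0 2)) (top_of_set ?D) (\<lambda>z :: real^'n. (e, z))"
    using e by (auto simp: continuous_map_subtopology_eu continuous_map_in_subtopology continuous_on_Pair)
  from continuous_map_compose[OF this cont]
  have cont2: "continuous_map (top_of_set (ball 0 2)) M (\<lambda>z. \<phi> (e, z))"
    by (simp add: o_def)
  have "openin (top_of_set (ball 0 2)) O'"
    using openin_continuous_map_preimage[OF cont2 U(3)] by (simp add: O'_def)
  then have open_O: "open O'" by (simp add: openin_open_eq)
  have "continuous_map (top_of_set O') (subtopology M U) (\<lambda>z. \<phi> (e, z))"
    unfolding continuous_map_in_subtopology
  proof
    show "continuous_map (top_of_set O') M (\<lambda>z. \<phi> (e, z))"
      by (rule continuous_map_from_subtopology_mono[OF cont2]) (auto simp: O'_def)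
  qed (auto simp: O'_def)
  from continuous_map_compose[OF this \<kappa>_cont]
  have "continuous_on O' (\<lambda>z. \<kappa> (\<phi> (e, z)))" by (simp add: o_def)
  moreover have "inj_on (\<lambda>z. \<kappa> (\<phi> (e, z))) O'"
  proof (rule inj_onI)
    fix z z' assume z: "z \<in> O'" "z' \<in> O'" "\<kappa> (\<phi> (e, z)) = \<kappa> (\<phi> (e, z'))"
    then have "\<phi> (e, z) = \<phi> (e, z')" using \<kappa>_inj by (auto simp: O'_def dest: inj_onD)
    then show "z = z'" using inj_onD[OF inj, of "(e, z)" "(e, z')"] e z by (auto simp: O'_def)
  qed
  ultimately have "open ((\<lambda>z. \<kappa> (\<phi> (e, z))) ` O')" (is "open ?B")
    using open_O by (intro invariance_of_domain)
  then have "openin (subtopology M U) {x \<in> topspace (subtopology M U). \<kappa> x \<in> ?B}"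
    by (intro openin_continuous_map_preimage[OF \<kappa>_cont]) simp
  then have T: "openin M {x \<in> topspace M \<inter> U. \<kappa> x \<in> ?B}" (is "openin M ?T")
    using U(3) by (simp add: openin_open_subtopology)
  have "?T \<subseteq> \<phi> ` (sphere 0 1 \<times> ball 0 2)"
  proof
    fix x assume "x \<in> ?T"
    then obtain z where z: "z \<in> O'" "x \<in> U" "\<kappa> x = \<kappa> (\<phi> (e, z))" by auto
    then have "x = \<phi> (e, z)" using \<kappa>_inj by (auto simp: O'_def dest: inj_onD)
    then show "x \<in> \<phi> ` (sphere 0 1 \<times> ball 0 2)" using z(1) e unfolding O'_def by blast
  qed
  moreover have "\<phi> (e, y) \<in> ?T" using U \<open>U \<subseteq> topspace M\<close> y by (auto simp: O'_def)
  ultimately show "\<exists>T. openin M T \<and> \<phi> (e, y) \<in> T \<and> T \<subseteq> \<phi> ` (sphere 0 1 \<times> ball 0 2)"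
    using T by blast
qed

text \<open>The Hausdorff property makes images of compact discs closed; the open image makes the
  part of \<open>M\<close> outside the open discs closed. Both closed sets are needed to paste maps
  along the spheres of radius 2.\<close>

locale embedded_discs =
  fixes M :: "'a topology" and \<phi> :: "real \<times> (real^'n) \<Rightarrow> 'a"
  assumes Hausdorff: "Hausdorff_space M"
    and embedding: "embedding_map (top_of_set (sphere 0 1 \<times> cball 0 3)) M \<phi>"
    and openin_image: "openin M (\<phi> ` (sphere 0 1 \<times> ball 0 2))"
begin

section \<open>The embedding and its inverse\<close>

lemma continuous_map_\<phi>: "continuous_map (top_of_set (sphere 0 1 \<times> cball 0 3)) M \<phi>"
  and inj_on_\<phi>: "inj_on \<phi> (sphere 0 1 \<times> cball 0 3)"
  using embedding
  by (auto simp: embedding_map_def homeomorphic_eq_everything_map continuous_map_in_subtopology)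

lemma \<phi>_in: "\<bar>e\<bar> = 1 \<Longrightarrow> norm y \<le> 3 \<Longrightarrow> \<phi> (e, y) \<in> topspace M"
  using continuous_map_funspace[OF continuous_map_\<phi>] by (auto simp: Pi_iff)

lemma \<phi>_eq_iff:
  assumes "\<bar>e\<bar> = 1" "\<bar>e'\<bar> = 1" "norm y \<le> 3" "norm y' \<le> 3"
  shows "\<phi> (e, y) = \<phi> (e', y') \<longleftrightarrow> e = e' \<and> y = y'"
  using inj_on_eq_iff[OF inj_on_\<phi>, of "(e, y)" "(e', y')"] assms by auto

lemma \<phi>_inverse:
  "\<exists>\<psi>. continuous_map (subtopology M (\<phi> ` (sphere 0 1 \<times> cball 0 3)))
      (top_of_set (sphere 0 1 \<times> cball 0 3)) \<psi> \<and>
    (\<forall>e y. \<bar>e\<bar> = 1 \<longrightarrow> norm y \<le> 3 \<longrightarrow> \<psi> (\<phi> (e, y)) = (e, y))"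
proof -
  obtain \<psi> where \<psi>: "homeomorphic_maps (top_of_set (sphere 0 1 \<times> cball 0 3))
      (subtopology M (\<phi> ` (sphere 0 1 \<times> cball 0 3))) \<phi> \<psi>"
    using embedding by (auto simp: embedding_map_def homeomorphic_map_maps)
  then show ?thesis
    by (intro exI[of _ \<psi>]) (auto simp: homeomorphic_maps_def)
qed

text \<open>
  The radial factor is \<open>\<bar>s\<bar> / 2\<close> for \<open>1 \<le> \<bar>s\<bar>\<close>: on the upper boundary, where \<open>(s, v)\<close> is the point
  \<open>(s, 2v)\<close> of the handle, this makes the retraction the identity on the open part.  It is
  \<open>0\<close> for \<open>\<bar>s\<bar> \<le> 1 / 2\<close>.
\<close>

definition trace_retract :: "(real \<times> 'a) + (real \<times> (real^'n)) \<Rightarrow> 'a" where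
  "trace_retract w = (case w of Inl (t, x) \<Rightarrow> x
     | Inr (s, y) \<Rightarrow> \<phi> (if 0 \<le> s then 1 else -1, max 0 (min (\<bar>s\<bar> / 2) (\<bar>s\<bar> - 1 / 2)) *\<^sub>R y))"

text \<open>On the cylinder the value is a default, since \<open>trace_middle\<close> lies in the
  handle.\<close>

definition trace_side :: "(real \<times> 'a) + (real \<times> (real^'n)) \<Rightarrow> bool" where
  "trace_side w = (case w of Inl (t, x) \<Rightarrow> True | Inr (s, y) \<Rightarrow> 0 \<le> s)"

definition trace_middle :: "((real \<times> 'a) + (real \<times> (real^'n))) set" where
  "trace_middle = Inr ` (ball 0 (1 / 2) \<times> cball 0 2)"

text \<open>The trace without the cocore disc \<open>s = 0\<close>, across which
  \<open>trace_retract\<close> jumps from one disc centre to the other. The ends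
  \<open>\<bar>s\<bar> = 2\<close> of the handle are represented by points of the cylinder.\<close>

definition trace_outer :: "((real \<times> 'a) + (real \<times> (real^'n))) set" where
  "trace_outer = Inl ` ({0..1} \<times> topspace M) \<union> Inr ` ((ball 0 2 - {0}) \<times> cball 0 2)"

text \<open>The restriction of the quotient map to the closed handle.\<close>

abbreviation glue :: "real \<times> (real^'n) \<Rightarrow> (real \<times> 'a) + (real \<times> (real^'n))" where
  "glue \<equiv> attach_map (sphere 0 2 \<times> cball 0 2) (\<lambda>(s, y). (1, \<phi> (sgn s, y)))"

section \<open>Open subsets of the trace\<close>

lemma glue_interior: "\<bar>s\<bar> < 2 \<Longrightarrow> glue (s, y) = Inr (s, y)"
  by (simp add: attach_map_def)

lemma glue_boundary: "\<bar>s\<bar> = 2 \<Longrightarrow> norm y \<le> 2 \<Longrightarrow> glue (s, y) = Inl (1, \<phi> (sgn s, y))"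
  by (simp add: attach_map_def)

lemma trace_attaching: "(\<lambda>(s, y). (1 :: real, \<phi> (sgn s, y))) ` (sphere 0 2 \<times> cball 0 2)
    \<subseteq> topspace (prod_topology (top_of_set {0..1}) M)"
  by (auto simp: sgn_if intro!: \<phi>_in)

lemma surgered_attaching: "(\<lambda>(s, v). \<phi> (sgn s, \<bar>s\<bar> *\<^sub>R v)) ` ((ball 0 2 - cball 0 1) \<times> sphere 0 1)
    \<subseteq> topspace (open_part M \<phi>)"
  by (auto simp: open_part_def \<phi>_in \<phi>_eq_iff abs_sgn_eq)

lemma topspace_surgery_trace: "topspace (surgery_trace M \<phi>) =
    Inl ` ({0..1} \<times> topspace M) \<union> Inr ` (ball 0 2 \<times> cball 0 2)"
  unfolding surgery_trace_def topspace_attach[OF trace_attaching] by auto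

lemma trace_middle_Un_outer: "trace_middle \<union> trace_outer = topspace (surgery_trace M \<phi>)"
  unfolding topspace_surgery_trace trace_middle_def trace_outer_def by (auto simp: image_iff)

lemma openin_surgery_traceI:
  assumes "V \<subseteq> topspace (surgery_trace M \<phi>)"
    and "openin (prod_topology (top_of_set {0..1}) M) {x \<in> {0..1} \<times> topspace M. Inl x \<in> V}"
    and "openin (top_of_set (cball 0 2 \<times> cball 0 2)) {z \<in> cball 0 2 \<times> cball 0 2.
      glue z \<in> V}"
  shows "openin (surgery_trace M \<phi>) V"
  using assms unfolding surgery_trace_def openin_attach topspace_attach[OF trace_attaching] by simp

text \<open>As \<open>S\<close> avoids \<open>\<bar>s\<bar> = 2\<close>, the set has empty preimage
  in the cylinder, and its preimage in the closed handle is
  \<open>S \<times> cball 0 2\<close>.\<close>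

lemma openin_trace_Inr:
  assumes "open S" "S \<subseteq> ball 0 2"
  shows "openin (surgery_trace M \<phi>) (Inr ` (S \<times> cball 0 2))"
proof (rule openin_surgery_traceI)
  have "glue z \<in> Inr ` (S \<times> cball 0 2) \<longleftrightarrow> z \<in> S \<times> UNIV" if "z \<in> cball 0 2 \<times> cball 0 2" for z
  proof (cases z)
    case (Pair s y)
    have "s \<notin> S" if "\<bar>s\<bar> = 2" using that assms(2) by auto
    with Pair that show ?thesis
      by (cases "\<bar>s\<bar> = 2") (auto simp: glue_boundary glue_interior)
  qed
  then have "{z \<in> cball 0 2 \<times> cball 0 2. glue z \<in> Inr ` (S \<times> cball 0 2)}
    = (cball 0 2 \<times> cball 0 2) \<inter> (S \<times> UNIV)"
    by blast
  then show "openin (top_of_set (cball 0 2 \<times> cball 0 2))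
      {z \<in> cball 0 2 \<times> cball 0 2. glue z \<in> Inr ` (S \<times> cball 0 2)}"
    using assms(1) by (simp add: openin_open_Int open_Times)
qed (use assms(2) in \<open>auto simp: topspace_surgery_trace image_iff\<close>)

lemma openin_trace_middle: "openin (surgery_trace M \<phi>) trace_middle"
  unfolding trace_middle_def by (rule openin_trace_Inr) auto

text \<open>Removing \<open>s = 0\<close> splits the middle of the handle into two open slabs, one
  for each value of \<open>trace_side\<close>.\<close>

lemma openin_trace_side:
  "openin (surgery_trace M \<phi>) {w \<in> trace_middle \<inter> trace_outer. trace_side w = b}"
proof -
  have "{w \<in> trace_middle \<inter> trace_outer. trace_side w = b} =
      Inr ` ((if b then {0<..<1 / 2} else {- (1 / 2)<..<0}) \<times> cball 0 2)"
    by (auto simp: trace_middle_def trace_outer_def trace_side_def image_iff)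
  moreover have "openin (surgery_trace M \<phi>)
      (Inr ` ((if b then {0<..<1 / 2} else {- (1 / 2)<..<0}) \<times> cball 0 2))"
    by (rule openin_trace_Inr) auto
  ultimately show ?thesis by simp
qed

text \<open>Continuity on \<open>trace_outer\<close> is tested on the two pieces of the quotient: on
  the cylinder the map is the projection, on the handle it is \<open>\<phi>\<close> after a radial
  shrinking, and the two agree along the attaching region.\<close>

lemma openin_trace_outer_preimage:
  assumes U: "openin M U"
  shows "openin (surgery_trace M \<phi>) {w \<in> trace_outer. trace_retract w \<in> U}"
proof (rule openin_surgery_traceI)
  show "{w \<in> trace_outer. trace_retract w \<in> U} \<subseteq> topspace (surgery_trace M \<phi>)"
    using trace_middle_Un_outer by blast
  have "{x \<in> {0..1} \<times> topspace M. Inl x \<in> {w \<in> trace_outer. trace_retract w \<in> U}} =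
      {x \<in> topspace (prod_topology (top_of_set {0..1}) M). snd x \<in> U}"
    by (auto simp: trace_outer_def trace_retract_def)
  then show "openin (prod_topology (top_of_set {0..1}) M)
      {x \<in> {0..1} \<times> topspace M. Inl x \<in> {w \<in> trace_outer. trace_retract w \<in> U}}"
    using openin_continuous_map_preimage[OF continuous_map_snd U] by (simp only:)
  let ?S = "cball 0 2 \<times> cball 0 2 :: (real \<times> (real^'n)) set"
  let ?S' = "(cball 0 2 - {0}) \<times> cball 0 2 :: (real \<times> (real^'n)) set"
  \<comment> \<open>Off \<open>s = 0\<close> the conditional in \<open>trace_retract\<close> equals
    \<open>sgn s\<close>, which is continuous there.\<close>
  let ?k = "\<lambda>z :: real \<times> (real^'n). (sgn (fst z), max 0 (min (\<bar>fst z\<bar> / 2) (\<bar>fst z\<bar> - 1 / 2)) *\<^sub>R snd z)"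
  have "continuous_on ?S' ?k"
    by (intro continuous_intros) auto
  moreover have "?k ` ?S' \<subseteq> sphere 0 1 \<times> cball 0 3"
  proof (rule image_subsetI)
    fix z assume z: "z \<in> ?S'"
    then have "max 0 (min (\<bar>fst z\<bar> / 2) (\<bar>fst z\<bar> - 1 / 2)) * norm (snd z) \<le> 1 * 2"
      by (intro mult_mono) auto
    then show "?k z \<in> sphere 0 1 \<times> cball 0 3"
      using z by (auto simp: abs_sgn_eq)
  qed
  ultimately have "continuous_map (top_of_set ?S') (top_of_set (sphere 0 1 \<times> cball 0 3)) ?k"
    by (simp add: continuous_map_subtopology_eu continuous_map_in_subtopology image_subset_iff_funcset)
  from continuous_map_compose[OF this continuous_map_\<phi>]
  have "openin (top_of_set ?S') {z \<in> topspace (top_of_set ?S'). (\<phi> \<circ> ?k) z \<in> U}"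
    using U by (rule openin_continuous_map_preimage)
  moreover have "?S' = ?S \<inter> ((- {0}) \<times> UNIV)" by auto
  then have "openin (top_of_set ?S) ?S'"
    by (simp only: openin_open_Int open_Times open_Compl closed_singleton open_UNIV)
  ultimately have "openin (top_of_set ?S) {z \<in> ?S'. (\<phi> \<circ> ?k) z \<in> U}"
    by (auto intro: openin_trans)
  moreover have "{z \<in> ?S. glue z
      \<in> {w \<in> trace_outer. trace_retract w \<in> U}} = {z \<in> ?S'. (\<phi> \<circ> ?k) z \<in> U}"
  proof (intro Collect_cong)
    fix z :: "real \<times> (real^'n)"
    obtain s y where z: "z = (s, y)" by (cases z)
    have "glue z \<in> {w \<in> trace_outer. trace_retract w \<in> U} \<longleftrightarrow> s \<noteq> 0 \<and> (\<phi> \<circ> ?k) z \<in> U"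
      if y: "norm y \<le> 2" and s: "\<bar>s\<bar> \<le> 2"
    proof (cases "\<bar>s\<bar> = 2")
      case True
      \<comment> \<open>At the ends of the handle the factor is the smaller of \<open>1\<close> and
        \<open>3 / 2\<close>, so the handle formula gives \<open>\<phi> (sgn s, y)\<close>, the
        point to which \<open>(s, y)\<close> is attached.\<close>
      then have "max 0 (min (\<bar>s\<bar> / 2) (\<bar>s\<bar> - 1 / 2)) = 1" by simp
      moreover have "\<phi> (sgn s, y) \<in> topspace M"
        using True y by (intro \<phi>_in) (auto simp: abs_sgn_eq)
      ultimately show ?thesis
        using True y by (auto simp: z glue_boundary trace_outer_def trace_retract_def)
    next
      case False
      then have "\<bar>s\<bar> < 2" using s by simp
      moreover have "sgn s = (if 0 \<le> s then 1 else -1)" if "s \<noteq> 0" using that by (auto simp: sgn_if)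
      ultimately show ?thesis
        using y by (auto simp: z glue_interior trace_outer_def trace_retract_def)
    qed
    then show "(z \<in> ?S \<and> glue z \<in> {w \<in> trace_outer. trace_retract w \<in> U}) \<longleftrightarrow> (z \<in> ?S' \<and> (\<phi> \<circ> ?k) z \<in> U)"
      by (auto simp: z)
  qed
  ultimately show "openin (top_of_set ?S)
      {z \<in> ?S. glue z
      \<in> {w \<in> trace_outer. trace_retract w \<in> U}}"
    by simp
qed

lemma trace_retract_in: "w \<in> trace_outer \<Longrightarrow> trace_retract w \<in> topspace M"
proof -
  have "\<phi> (e, max 0 (min (\<bar>s\<bar> / 2) (\<bar>s\<bar> - 1 / 2)) *\<^sub>R y) \<in> topspace M"
    if "\<bar>e\<bar> = 1" "\<bar>s\<bar> \<le> 2" "norm y \<le> 2" for e s y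
  proof (intro \<phi>_in)
    have "max 0 (min (\<bar>s\<bar> / 2) (\<bar>s\<bar> - 1 / 2)) * norm y \<le> 1 * 2"
      using that by (intro mult_mono) auto
    then show "norm (max 0 (min (\<bar>s\<bar> / 2) (\<bar>s\<bar> - 1 / 2)) *\<^sub>R y) \<le> 3" by simp
  qed (rule that)
  then show "w \<in> trace_outer \<Longrightarrow> trace_retract w \<in> topspace M"
    by (auto simp: trace_outer_def trace_retract_def)
qed

lemma openin_trace_outer: "openin (surgery_trace M \<phi>) trace_outer"
proof -
  have "{w \<in> trace_outer. trace_retract w \<in> topspace M} = trace_outer"
    using trace_retract_in by blast
  then show ?thesis using openin_trace_outer_preimage[OF openin_topspace] by simp
qed

lemma continuous_map_trace_retract:
  "continuous_map (subtopology (surgery_trace M \<phi>) trace_outer) M trace_retract"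
proof -
  have "topspace (subtopology (surgery_trace M \<phi>) trace_outer) = trace_outer"
    using trace_middle_Un_outer by auto
  then show ?thesis
    unfolding continuous_map
    using openin_trace_outer_preimage openin_trace_outer trace_retract_in
    by (auto simp: openin_open_subtopology)
qed

lemma trace_retract_middle:
  "w \<in> trace_middle \<Longrightarrow> trace_retract w = \<phi> (if trace_side w then 1 else -1, 0)"
  by (auto simp: trace_middle_def trace_retract_def trace_side_def)

section \<open>The two boundary inclusions\<close>

lemma continuous_map_trace_lower: "continuous_map M (surgery_trace M \<phi>) trace_lower"
proof -
  have "continuous_map M (prod_topology (top_of_set {0..1}) M) (\<lambda>x. (0 :: real, x))"
    by (simp add: continuous_map_pairwise o_def)
  from continuous_map_compose[OF this continuous_map_attach_Inl[OF trace_attaching]]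
  show ?thesis unfolding surgery_trace_def trace_lower_def o_def .
qed

lemma trace_upper_Inl_disc:
  assumes "\<bar>e\<bar> = 1" "norm y < 2"
  shows "trace_upper \<phi> (Inl (\<phi> (e, y))) = Inr (e * norm y, (2 / norm y) *\<^sub>R y)"
proof -
  have "inj_on \<phi> (sphere 0 1 \<times> ball 0 2)"
    by (rule inj_on_subset[OF inj_on_\<phi>]) auto
  then have "inv_into (sphere 0 1 \<times> ball 0 2) \<phi> (\<phi> (e, y)) = (e, y)"
    using assms by (intro inv_into_f_f) auto
  then show ?thesis
    using assms by (simp add: trace_upper_def)
qed

lemma open_part_cases:
  assumes "x \<in> topspace (open_part M \<phi>)"
  obtains (disc) e y where "\<bar>e\<bar> = 1" "1 < norm y" "norm y < 2" "x = \<phi> (e, y)"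
  | (outside) "x \<in> topspace M" "x \<notin> \<phi> ` (sphere 0 1 \<times> ball 0 2)"
proof (cases "x \<in> \<phi> ` (sphere 0 1 \<times> ball 0 2)")
  case True
  then obtain e y where y: "\<bar>e\<bar> = 1" "norm y < 2" "x = \<phi> (e, y)" by auto
  moreover have "1 < norm y"
  proof (rule ccontr)
    assume "\<not> 1 < norm y"
    then have "x \<in> \<phi> ` (sphere 0 1 \<times> cball 0 1)" using y by auto
    then show False using assms by (simp add: open_part_def)
  qed
  ultimately show thesis by (intro disc)
next
  case False
  then show thesis using assms by (intro outside) (simp_all add: open_part_def)
qed

text \<open>A point \<open>\<phi> (e, y)\<close> with \<open>1 < norm y < 2\<close> goes to the
  handle coordinate \<open>s = e * norm y\<close>, which is outside the middle; there the factor
  \<open>\<bar>s\<bar> / 2\<close> undoes the scaling by \<open>2 / norm y\<close>.\<close>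

lemma trace_upper_open_part:
  assumes "x \<in> topspace (open_part M \<phi>)"
  shows "trace_upper \<phi> (Inl x) \<notin> trace_middle" "trace_retract (trace_upper \<phi> (Inl x)) = x"
  using assms
proof (atomize(full), cases rule: open_part_cases)
  case (disc e y)
  then have "max 0 (min (\<bar>e * norm y\<bar> / 2) (\<bar>e * norm y\<bar> - 1 / 2)) *\<^sub>R (2 / norm y) *\<^sub>R y = y"
    by (simp add: abs_mult)
  moreover have "(if 0 \<le> e * norm y then 1 else -1) = e"
    using disc by (cases "e = 1") (auto simp: zero_le_mult_iff abs_if split: if_splits)
  ultimately show "trace_upper \<phi> (Inl x) \<notin> trace_middle \<and> trace_retract (trace_upper \<phi> (Inl x)) = x"
    using disc by (auto simp: trace_upper_Inl_disc trace_middle_def trace_retract_def abs_mult)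
next
  case outside
  then show "trace_upper \<phi> (Inl x) \<notin> trace_middle \<and> trace_retract (trace_upper \<phi> (Inl x)) = x"
    by (auto simp: trace_upper_def trace_middle_def trace_retract_def)
qed

text \<open>Pasting on two closed sets: the annuli up to radius 2, read in the handle, and the part
  outside the open discs, read in the top of the cylinder. On the common spheres of radius 2 the
  attaching map identifies the two readings.\<close>

lemma continuous_map_trace_upper_Inl:
  "continuous_map (open_part M \<phi>) (surgery_trace M \<phi>) (\<lambda>x. trace_upper \<phi> (Inl x))"
proof -
  \<comment> \<open>Polar coordinates: the radius becomes the core coordinate of the handle, and the
    direction is scaled to length 2. Continuity requires \<open>y \<noteq> 0\<close>, which holds on
    the open part.\<close>
  let ?g = "\<lambda>z :: real \<times> (real^'n). (fst z * norm (snd z), (2 / norm (snd z)) *\<^sub>R snd z)"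
  obtain \<psi> where \<psi>_cont: "continuous_map (subtopology M (\<phi> ` (sphere 0 1 \<times> cball 0 3)))
      (top_of_set (sphere 0 1 \<times> cball 0 3)) \<psi>"
    and \<psi>: "\<And>e y. \<bar>e\<bar> = 1 \<Longrightarrow> norm y \<le> 3 \<Longrightarrow> \<psi> (\<phi> (e, y)) = (e, y)"
    using \<phi>_inverse by blast
  let ?T = "\<lambda>b. topspace (open_part M \<phi>) \<inter>
    (if b then \<phi> ` (sphere 0 1 \<times> cball 0 2) else topspace M - \<phi> ` (sphere 0 1 \<times> ball 0 2))"
  let ?f = "\<lambda>b x. if b then glue (?g (\<psi> x)) else Inl (1, x)"
  show ?thesis
  proof (rule pasting_lemma_closed[of "UNIV :: bool set" _ ?T _ ?f])
    fix b :: bool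
    have "compactin M (\<phi> ` (sphere 0 1 \<times> cball 0 2))"
    proof (rule image_compactin[OF _ continuous_map_\<phi>])
      show "compactin (top_of_set (sphere 0 1 \<times> cball 0 3)) 
          (sphere 0 1 \<times> cball 0 2 :: (real \<times> (real^'n)) set)"
        by (auto simp: compactin_subtopology intro!: compact_Times)
    qed
    then have "closedin M (\<phi> ` (sphere 0 1 \<times> cball 0 2))"
      by (rule compactin_imp_closedin[OF Hausdorff])
    moreover have "closedin M (topspace M - \<phi> ` (sphere 0 1 \<times> ball 0 2))"
      using openin_image by blast
    ultimately have "closedin M (if b then \<phi> ` (sphere 0 1 \<times> cball 0 2)
        else topspace M - \<phi> ` (sphere 0 1 \<times> ball 0 2))"
      by simp
    then show "closedin (open_part M \<phi>) (?T b)"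
      unfolding open_part_def closedin_subtopology by auto
    show "continuous_map (subtopology (open_part M \<phi>) (?T b)) (surgery_trace M \<phi>) (?f b)"
    proof (cases b)
      case True
      let ?S = "sphere 0 1 \<times> (cball 0 2 - cball 0 1) :: (real \<times> (real^'n)) set"
      have T: "x \<in> \<phi> ` ?S" if "x \<in> ?T True" for x
        using that by (auto simp: open_part_def)
      have "continuous_map (subtopology (open_part M \<phi>) (?T True)) (top_of_set ?S) \<psi>"
        unfolding continuous_map_in_subtopology
      proof
        have 1: "continuous_map (subtopology M (\<phi> ` (sphere 0 1 \<times> cball 0 3))) euclidean \<psi>"
          using \<psi>_cont by (simp add: continuous_map_in_subtopology)
        have 2: "subtopology (open_part M \<phi>) (?T True) = subtopology M (?T True)"
          unfolding open_part_def by (simp add: subtopology_subtopology Int_absorb1 Int_assoc[symmetric])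
        have "?T True \<subseteq> \<phi> ` (sphere 0 1 \<times> cball 0 3)"
          using T by fastforce
        then show "continuous_map (subtopology (open_part M \<phi>) (?T True)) euclidean \<psi>"
          unfolding 2 by (rule continuous_map_from_subtopology_mono[OF 1])
        have "\<psi> x \<in> ?S" if x: "x \<in> ?T True" for x
        proof -
          obtain e y where y: "(e, y) \<in> ?S" "x = \<phi> (e, y)" using T[OF x] by blast
          then show ?thesis using \<psi>[of e y] by simp
        qed
        then show "\<psi> \<in> topspace (subtopology (open_part M \<phi>) (?T True)) \<rightarrow> ?S"
          unfolding topspace_subtopology by (intro Pi_I) blast
      qed
      moreover have "continuous_map (top_of_set ?S) (top_of_set (cball 0 2 \<times> cball 0 2)) ?g"
      proof -
        have "continuous_on ?S ?g" by (intro continuous_intros) auto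
        moreover have "?g \<in> ?S \<rightarrow> cball 0 2 \<times> cball 0 2" by (auto simp: abs_mult)
        ultimately show ?thesis by (simp add: continuous_map_in_subtopology)
      qed
      moreover have "continuous_map (top_of_set (cball 0 2 \<times> cball 0 2)) (surgery_trace M \<phi>) glue"
        unfolding surgery_trace_def by (rule continuous_map_attach_map[OF trace_attaching])
      ultimately have "continuous_map (subtopology (open_part M \<phi>) (?T True)) (surgery_trace M \<phi>) (glue \<circ> (?g \<circ> \<psi>))"
        by (intro continuous_map_compose)
      then show ?thesis using True by (simp add: o_def)
    next
      case False
      have "continuous_map M (prod_topology (top_of_set {0..1}) M) (\<lambda>x. (1 :: real, x))"
        by (simp add: continuous_map_pairwise o_def)
      from continuous_map_compose[OF this continuous_map_attach_Inl[OF trace_attaching]]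
      have "continuous_map M (surgery_trace M \<phi>) (\<lambda>x. Inl (1, x))"
        unfolding surgery_trace_def o_def .
      then show ?thesis using False
        unfolding open_part_def by (simp add: continuous_map_from_subtopology)
    qed
  next
    have sgn_eq: "sgn (e * 2) = e" if "\<bar>e\<bar> = 1" for e :: real
      using that by (auto simp: abs_if split: if_splits)
    fix b c x
    have *: "glue (?g (\<psi> x)) = Inl (1, x)" if x: "x \<in> ?T True \<inter> ?T False"
    proof -
      obtain e y where y: "\<bar>e\<bar> = 1" "norm y \<le> 2" "x = \<phi> (e, y)" using x by auto
      have "norm y = 2"
      proof (rule ccontr)
        assume "norm y \<noteq> 2"
        then have "x \<in> \<phi> ` (sphere 0 1 \<times> ball 0 2)" using y by auto
        then show False using x by simp
      qed
      then show ?thesis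
        using y sgn_eq[of e] by (simp add: \<psi> glue_boundary abs_mult)
    qed
    show "?f b x = ?f c x" if "x \<in> topspace (open_part M \<phi>) \<inter> ?T b \<inter> ?T c"
      using * that by (cases b; cases c) simp_all
  next
    fix x assume x: "x \<in> topspace (open_part M \<phi>)"
    then show "\<exists>b. b \<in> UNIV \<and> x \<in> ?T b \<and> trace_upper \<phi> (Inl x) = ?f b x"
    proof (cases rule: open_part_cases)
      case (disc e y)
      then have "trace_upper \<phi> (Inl x) = ?f True x"
        by (simp add: trace_upper_Inl_disc \<psi> glue_interior abs_mult)
      moreover have "x \<in> ?T True" using x disc by auto
      ultimately show ?thesis by blast
    next
      case outside
      then have "trace_upper \<phi> (Inl x) = ?f False x" by (auto simp: trace_upper_def)
      moreover have "x \<in> ?T False" using x outside by auto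
      ultimately show ?thesis by blast
    qed
  qed simp
qed

text \<open>On the handle of the surgered manifold the map is
  \<open>(s, v) \<mapsto> (s, 2 v)\<close> followed by \<open>glue\<close>. For
  \<open>1 < \<bar>s\<bar>\<close> the point is represented in the open part, and polar coordinates
  there recover \<open>s\<close> and \<open>v\<close>.\<close>

lemma continuous_map_trace_upper:
  "continuous_map (surgered M \<phi>) (surgery_trace M \<phi>) (trace_upper \<phi>)"
  unfolding surgered_def
proof (rule continuous_map_from_attach[OF surgered_attaching continuous_map_trace_upper_Inl])
  let ?a = "attach_map ((ball 0 2 - cball 0 1) \<times> sphere 0 1) (\<lambda>(s, v). \<phi> (sgn s, \<bar>s\<bar> *\<^sub>R v))"
  let ?S = "ball 0 2 \<times> sphere 0 1 :: (real \<times> (real^'n)) set"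
  have "continuous_on ?S (\<lambda>z. (fst z, 2 *\<^sub>R snd z))" by (intro continuous_intros)
  then have "continuous_map (top_of_set ?S) (top_of_set (cball 0 2 \<times> cball 0 2)) (\<lambda>z. (fst z, 2 *\<^sub>R snd z))"
    by (auto simp: continuous_map_in_subtopology)
  from continuous_map_compose[OF this continuous_map_attach_map[OF trace_attaching]]
  have "continuous_map (top_of_set ?S) (surgery_trace M \<phi>) (\<lambda>z. glue (fst z, 2 *\<^sub>R snd z))"
    by (simp add: surgery_trace_def o_def)
  then show "continuous_map (top_of_set ?S) (surgery_trace M \<phi>) (\<lambda>z. trace_upper \<phi> (?a z))"
  proof (rule continuous_map_eq)
    fix z assume "z \<in> topspace (top_of_set ?S)"
    then obtain s v where z: "z = (s, v)" "\<bar>s\<bar> < 2" "norm v = 1" by (cases z) auto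
    show "glue (fst z, 2 *\<^sub>R snd z) = trace_upper \<phi> (?a z)"
    proof (cases "1 < \<bar>s\<bar>")
      case True
      then have "trace_upper \<phi> (Inl (\<phi> (sgn s, \<bar>s\<bar> *\<^sub>R v))) = Inr (s, 2 *\<^sub>R v)"
        using z by (subst trace_upper_Inl_disc) (auto simp: abs_sgn_eq sgn_mult_abs)
      then show ?thesis using True z by (simp add: glue_interior) (simp add: attach_map_def)
    next
      case False
      then show ?thesis using z by (simp add: glue_interior) (simp add: attach_map_def trace_upper_def)
    qed
  qed
qed

text \<open>The \<open>clutching\<close> construction, fed with the retraction, yields a structure
  on the whole trace; its restriction to the upper boundary is the surgery. The linear parts
  \<open>A\<close> stay free so that they can be adapted to an orientation.\<close>

lemma foliation_surgery_exists:
  fixes F :: "('i, 'a, 'q::finite) haefliger" and A :: "bool \<Rightarrow> real^'q \<Rightarrow> real^'q"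
  assumes F: "haefliger_structure M F"
    and \<alpha>: "\<And>b. \<alpha> b \<in> hs_index F" "\<And>b. \<phi> (if b then 1 else -1, 0) \<in> hs_dom F (\<alpha> b)"
    and A: "\<And>b. involution (A b)"
  obtains F' where "strong_foliation_surgery M F \<phi> F'"
    "\<And>\<omega>. transverse_orientation M F \<omega> \<Longrightarrow> (\<And>b. det (matrix (A b)) \<in> {-1, 1}) \<Longrightarrow>
      (\<And>b. det (matrix (A b)) * \<omega> (\<alpha> b) (\<phi> (if b then 1 else -1, 0)) = 1) \<Longrightarrow>
      transversely_orientable (surgered M \<phi>) F'"
proof -
  let ?W = "surgery_trace M \<phi>" and ?S = "surgered M \<phi>" and ?O = "open_part M \<phi>"
  interpret clutching ?W M F trace_middle trace_outer trace_retract trace_side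
      "\<lambda>b. \<phi> (if b then 1 else -1, 0)" \<alpha> A
    by unfold_locales
       (rule F openin_trace_middle openin_trace_outer trace_middle_Un_outer continuous_map_trace_retract
         trace_retract_middle openin_trace_side \<alpha> A | assumption)+
  note cont = continuous_map_trace_upper continuous_map_trace_lower
  \<comment> \<open>Refining brings the index type into the form that
    \<open>lax_foliation_surgery\<close> prescribes; the same is done for \<open>F'\<close>.\<close>
  obtain G :: "((real \<times> 'a) + (real \<times> (real^'n)), (real \<times> 'a) + (real \<times> (real^'n)), 'q) haefliger"
    where G: "haefliger_structure ?W G" "haefliger_refines G clutch"
    using refinement_indexed_by_points[OF haefliger_structure_clutch, of "\<lambda>w. w" "topspace ?W"] by auto
  let ?G' = "haefliger_pullback ?S (trace_upper \<phi>) G"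
  have G': "haefliger_structure ?S ?G'"
    by (rule haefliger_structure_pullback[OF G(1) cont(1)])
  obtain F' :: "('a + real \<times> (real^'n), 'a + real \<times> (real^'n), 'q) haefliger"
    where F': "haefliger_structure ?S F'" "haefliger_refines F' ?G'"
    using refinement_indexed_by_points[OF G', of "\<lambda>w. w" "topspace ?S"] by auto
  have F'_clutch: "haefliger_refines F' (haefliger_pullback ?S (trace_upper \<phi>) clutch)"
    by (rule haefliger_refines_trans[OF F'(2) haefliger_refines_pullback[OF G(2)]])
  have Inl: "continuous_map ?O ?S Inl"
    unfolding surgered_def by (rule continuous_map_attach_Inl[OF surgered_attaching])
  have id: "continuous_map ?O M (\<lambda>x. x)" by (simp add: open_part_def continuous_map_from_subtopology)
  have "haefliger_refines (haefliger_pullback ?O Inl F')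
      (haefliger_pullback ?O (\<lambda>x. trace_upper \<phi> (Inl x)) clutch)"
    using haefliger_refines_pullback[OF F'_clutch, of ?O Inl]
    unfolding haefliger_pullback_pullback[OF continuous_map_funspace[OF Inl]] .
  \<comment> \<open>On the open part the upper inclusion avoids the middle, and the retraction after
    it is the identity.\<close>
  moreover have "haefliger_refines (haefliger_pullback ?O (\<lambda>x. trace_upper \<phi> (Inl x)) clutch)
      (haefliger_pullback ?O (\<lambda>x. x) F)"
    by (intro clutch_pullback_refines conjI trace_upper_open_part)
  ultimately have "haefliger_refines (haefliger_pullback ?O Inl F') (haefliger_pullback ?O (\<lambda>x. x) F)"
    by (rule haefliger_refines_trans)
  then have weak: "weak_foliation_surgery M F \<phi> F'"
    unfolding weak_foliation_surgery_def
    by (intro conjI F'(1) haefliger_equivalentI[OF _ _ _ haefliger_refines_refl]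
        haefliger_structure_pullback[OF F'(1) Inl] haefliger_structure_pullback[OF F id])
  \<comment> \<open>The lower boundary lies in the cylinder, where the retraction is the projection
    to \<open>M\<close>.\<close>
  have "haefliger_refines (haefliger_pullback M trace_lower clutch) (haefliger_pullback M (\<lambda>x. x) F)"
    by (rule clutch_pullback_refines) (auto simp: trace_lower_def trace_middle_def trace_retract_def)
  moreover have "haefliger_refines (haefliger_pullback M (\<lambda>x. x) F) F"
    by (rule haefliger_refinesI[of _ "\<lambda>a. a"]) auto
  ultimately have "haefliger_refines (haefliger_pullback M trace_lower clutch) F"
    by (rule haefliger_refines_trans)
  then have lower: "haefliger_refines (haefliger_pullback M trace_lower G) F"
    by (rule haefliger_refines_trans[OF haefliger_refines_pullback[OF G(2)]])
  have "haefliger_equivalent M (haefliger_pullback M trace_lower G) F"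
    by (rule haefliger_equivalentI[OF _ F _ haefliger_refines_refl lower])
       (rule haefliger_structure_pullback[OF G(1) cont(2)])+
  moreover have "haefliger_equivalent ?S ?G' F'"
    by (rule haefliger_equivalentI[OF G' F'(1) F'(1) F'(2) haefliger_refines_refl])
  ultimately have "lax_foliation_surgery M F \<phi> F'"
    unfolding lax_foliation_surgery_def by (intro conjI exI[of _ G] F'(1) G(1))
  with weak have "strong_foliation_surgery M F \<phi> F'"
    by (simp add: strong_foliation_surgery_def)
  then show thesis
  proof (rule that)
    fix \<omega> assume "transverse_orientation M F \<omega>" "\<And>b. det (matrix (A b)) \<in> {-1, 1}"
      "\<And>b. det (matrix (A b)) * \<omega> (\<alpha> b) (\<phi> (if b then 1 else -1, 0)) = 1"
    from transversely_orientable_refines[OF transverse_orientation_pullback[OF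
        clutch_orientation[OF this] cont(1)] F'_clutch]
    show "transversely_orientable ?S F'" .
  qed
qed

end

theorem proposition4p1:
  fixes M :: "'a topology" and \<A> :: "('a set \<times> ('a \<Rightarrow> real^'n)) set"
    and F :: "('i, 'a, 'q::finite) haefliger" and \<phi> :: "real \<times> (real^'n) \<Rightarrow> 'a"
  assumes "smooth_manifold M \<A>"
    and "haefliger_structure M F"
    and "smooth_embedding_discs M \<A> \<phi>"
  shows "(\<exists>F'. strong_foliation_surgery M F \<phi> F') \<and>
         (\<forall>\<omega>. transverse_orientation M F \<omega> \<longrightarrow>
           (\<exists>F'. strong_foliation_surgery M F \<phi> F' \<and> transversely_orientable (surgered M \<phi>) F'))"
proof -
  have emb: "embedding_map (top_of_set (sphere 0 1 \<times> cball 0 3)) M \<phi>"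
    using assms(3) by (simp add: smooth_embedding_discs_def)
  interpret embedded_discs M \<phi>
    using assms(1) emb openin_disc_image[OF assms(1) emb]
    by unfold_locales (simp_all add: smooth_manifold_def)
  let ?p = "\<lambda>b. \<phi> (if b then 1 else -1, 0)"
  have "\<forall>b. \<exists>a. a \<in> hs_index F \<and> ?p b \<in> hs_dom F a"
  proof
    fix b
    have "?p b \<in> (\<Union>a\<in>hs_index F. hs_dom F a)"
      unfolding hs_cover[OF assms(2)] by (intro \<phi>_in) auto
    then show "\<exists>a. a \<in> hs_index F \<and> ?p b \<in> hs_dom F a" by auto
  qed
  then obtain \<alpha> where \<alpha>: "\<And>b. \<alpha> b \<in> hs_index F" "\<And>b. ?p b \<in> hs_dom F (\<alpha> b)"
    by metis
  obtain R :: "real^'q \<Rightarrow> real^'q" where R: "involution R" "det (matrix R) = -1"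
    using reflection_exists by blast
  have id: "det (matrix (\<lambda>x :: real^'q. x)) = 1"
    by (simp add: matrix_id_mat_1 flip: id_def)
  have "\<exists>F'. strong_foliation_surgery M F \<phi> F'"
    by (rule foliation_surgery_exists[OF assms(2) \<alpha>, of "\<lambda>b x. x"]) (rule involution_id, rule exI)
  moreover have "\<exists>F'. strong_foliation_surgery M F \<phi> F' \<and> transversely_orientable (surgered M \<phi>) F'"
    if \<omega>: "transverse_orientation M F \<omega>" for \<omega>
  proof -
    \<comment> \<open>A reflection is used exactly where the given orientation is negative in the
      chosen chart at the disc centre; the new chart then has sign \<open>1\<close> on both
      sides.\<close>
    define A where "A b = (if \<omega> (\<alpha> b) (?p b) = 1 then (\<lambda>x. x) else R)" for b
    have A: "involution (A b)" for b by (simp add: A_def involution_id R)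
    have detA: "det (matrix (A b)) \<in> {-1, 1}" for b by (simp add: A_def id R)
    have norm: "det (matrix (A b)) * \<omega> (\<alpha> b) (?p b) = 1" for b
    proof -
      have "continuous_map (subtopology M (hs_dom F (\<alpha> b))) (discrete_topology {-1, 1}) (\<omega> (\<alpha> b))"
        by (rule \<omega>[unfolded transverse_orientation_def bundle_orientation_def, THEN conjunct1, rule_format, OF \<alpha>(1)])
      moreover have "?p b \<in> topspace M" by (intro \<phi>_in) auto
      ultimately have "\<omega> (\<alpha> b) (?p b) \<in> {-1, 1}"
        using \<alpha>(2)[of b] by (auto dest!: continuous_map_funspace simp: Pi_iff)
      then show ?thesis by (auto simp: A_def id R)
    qed
    show ?thesis
    proof (rule foliation_surgery_exists[OF assms(2) \<alpha> A])
      fix F'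
      assume "strong_foliation_surgery M F \<phi> F'"
        and "\<And>\<omega>. transverse_orientation M F \<omega> \<Longrightarrow> (\<And>b. det (matrix (A b)) \<in> {-1, 1}) \<Longrightarrow>
        (\<And>b. det (matrix (A b)) * \<omega> (\<alpha> b) (?p b) = 1) \<Longrightarrow> transversely_orientable (surgered M \<phi>) F'"
      from this(1) this(2)[OF \<omega> detA norm]
      show "\<exists>F'. strong_foliation_surgery M F \<phi> F' \<and> transversely_orientable (surgered M \<phi>) F'"
        by (intro exI[of _ F'] conjI)
    qed
  qed
  ultimately show ?thesis by blast
qed

end
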